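(* Let $G$ be a finite group, $k\ge 1$, and $\emptyset\neq A\subset G$. Then \[ \mu_{k-1}(Y_{A,k}) \;\geq\; |A|-k\cdot \nu(A). \]
   Context: Let $G$ be a finite group of order $n$ and $k\ge1$. For $1\le i\le k+1$ let $V_i=\{i\}\times G$, viewed as a $0$-dimensional complex. $Y_{G,k}$ denotes the simplicial join $V_1*\cdots*V_{k+1}$, i.e. the simplicial complex on vertex set $V_1\cup\cdots\cup V_{k+1}$ whose simplices are the sets containing at most one vertex from each $V_i$. For $A\subset G$, $Y_{A,k}$ is the subcomplex of $Y_{G,k}$ containing the full $(k-1)$-skeleton of $Y_{G,k}$ and whose $k$-simplices are the sets $\{(1,x_1),\ldots,(k+1,x_{k+1})\}$ with $x_1x_2\cdots x_{k+1}\in A$. For a simplicial complex $X$ and $j\ge0$, $C^j(X)$ is the real vector space of real-valued skew-symmetric functions on ordered $j$-simplices, $C^{-1}(X)=\mathbb R$; the coboundary $d_j:C^j\to C^{j+1}$ is $d_j\phi([v_0,\dots,v_{j+1}])=\sum_i(-1)^i\phi([v_0,\dots,\widehat{v_i},\dots,v_{j+1}])$, and $d_{-1}(a)(v)=a$. Each $C^j(X)$ has the standard inner product $(\phi,\psi)_X=\sum_{\sigma\in X(j)}\phi(\sigma)\psi(\sigma)$ (one fixed orientation per simplex), and $d_j^*$ denotes the adjoint. The reduced $j$-th Laplacian is $L_j(X)=d_{j-1}d_{j-1}^*+d_j^*d_j$ on $C^j(X)$, and $\mu_j(X)$ denotes its minimal eigenvalue (the $j$-th spectral gap). Let $\widehat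 G_+$ be the set of (isomorphism classes of) nontrivial irreducible unitary complex representations $\rho:G\to U(d_\rho)$. For $\rho$ let $\widehat{1_A}(\rho)=\sum_{a\in A}\rho(a)\in M_{d_\rho}(\mathbb C)$, and let $\nu(A)=\max_{\rho\in\widehat G_+}\|\widehat{1_A}(\rho)\|$, where $\|\cdot\|$ is the spectral (operator) norm. *)

theory Defs
  imports "Jordan_Normal_Form.Schur_Decomposition" "HOL-Combinatorics.Permutations"
    "HOL-Algebra.Group"
begin

text \<open>A simplicial complex is given by its set of simplices (finite vertex sets),
  which here always contains the empty simplex; ordered simplices are lists of
  distinct vertices. Ordered simplices with m vertices (m = j+1) carry j-cochains;
  m = 0 (the empty list) gives C^(-1) = R, and the coboundary formula for m = 0
  gives exactly d_(-1)(a)(v) = a.\<close>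

definition osimp :: "'v set set \<Rightarrow> nat \<Rightarrow> 'v list set" where
  "osimp X m = {xs. distinct xs \<and> length xs = m \<and> set xs \<in> X}"

definition cochains :: "'v set set \<Rightarrow> nat \<Rightarrow> ('v list \<Rightarrow> real) set" where
  "cochains X m = {\<phi>. (\<forall>xs. xs \<notin> osimp X m \<longrightarrow> \<phi> xs = 0) \<and>
      (\<forall>xs\<in>osimp X m. \<forall>p. p permutes {..<m} \<longrightarrow>
          \<phi> (permute_list p xs) = real_of_int (sign p) * \<phi> xs)}"

definition cobd :: "'v set set \<Rightarrow> nat \<Rightarrow> ('v list \<Rightarrow> real) \<Rightarrow> ('v list \<Rightarrow> real)" where
  "cobd X m \<phi> = (\<lambda>xs. if xs \<in> osimp X (Suc m)
      then (\<Sum>i<Suc m. (-1) ^ i * \<phi> (take i xs @ drop (Suc i) xs)) else 0)"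

definition orient :: "'v set \<Rightarrow> 'v list" where
  "orient \<sigma> = (SOME xs. distinct xs \<and> set xs = \<sigma>)"

definition cinner :: "'v set set \<Rightarrow> nat \<Rightarrow> ('v list \<Rightarrow> real) \<Rightarrow> ('v list \<Rightarrow> real) \<Rightarrow> real" where
  "cinner X m \<phi> \<psi> = (\<Sum>\<sigma>\<in>{\<sigma>\<in>X. finite \<sigma> \<and> card \<sigma> = m}. \<phi> (orient \<sigma>) * \<psi> (orient \<sigma>))"

definition cobd_adj :: "'v set set \<Rightarrow> nat \<Rightarrow> ('v list \<Rightarrow> real) \<Rightarrow> ('v list \<Rightarrow> real)" where
  "cobd_adj X m \<psi> = (THE \<phi>. \<phi> \<in> cochains X m \<and>
      (\<forall>\<chi>\<in>cochains X m. cinner X (Suc m) (cobd X m \<chi>) \<psi> = cinner X m \<chi> \<phi>))"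

text \<open>Reduced Laplacian on cochains on m-vertex simplices, m \<ge> 1 (i.e. L_j, j = m-1).\<close>
definition laplacian :: "'v set set \<Rightarrow> nat \<Rightarrow> ('v list \<Rightarrow> real) \<Rightarrow> ('v list \<Rightarrow> real)" where
  "laplacian X m \<phi> = (\<lambda>xs. cobd X (m - 1) (cobd_adj X (m - 1) \<phi>) xs
                        + cobd_adj X m (cobd X m \<phi>) xs)"

definition lap_eigenvalues :: "'v set set \<Rightarrow> nat \<Rightarrow> real set" where
  "lap_eigenvalues X m = {e. \<exists>\<phi>\<in>cochains X m. \<phi> \<noteq> (\<lambda>_. 0) \<and>
      laplacian X m \<phi> = (\<lambda>xs. e * \<phi> xs)}"

text \<open>Spectral gap mu_j(X), j = m-1: the minimal eigenvalue of L_j.\<close>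
definition spectral_gap :: "'v set set \<Rightarrow> nat \<Rightarrow> real" where
  "spectral_gap X m = Min (lap_eigenvalues X m)"

definition gprod :: "('a, 'b) monoid_scheme \<Rightarrow> 'a list \<Rightarrow> 'a" where
  "gprod G xs = foldr (\<lambda>x y. x \<otimes>\<^bsub>G\<^esub> y) xs \<one>\<^bsub>G\<^esub>"

text \<open>Vertices are pairs (i, g), i in {1..k+1}, g in G. Simplices: vertex sets with at most
  one vertex per level; all of them with at most k vertices (full (k-1)-skeleton, including
  the empty simplex), and the k-simplices {(1,x_1),...,(k+1,x_(k+1))} with x_1...x_(k+1) in A.\<close>
definition Ycomplex :: "('a, 'b) monoid_scheme \<Rightarrow> 'a set \<Rightarrow> nat \<Rightarrow> (nat \<times> 'a) set set" where
  "Ycomplex G A k = {\<sigma>. \<sigma> \<subseteq> {1..Suc k} \<times> carrier G \<and>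
      (\<forall>i x y. (i, x) \<in> \<sigma> \<longrightarrow> (i, y) \<in> \<sigma> \<longrightarrow> x = y) \<and>
      (card \<sigma> \<le> k \<or>
       (card \<sigma> = Suc k \<and> gprod G (map (\<lambda>i. THE x. (i, x) \<in> \<sigma>) [1..<k + 2]) \<in> A))}"

definition vnorm :: "complex vec \<Rightarrow> real" where
  "vnorm v = sqrt (\<Sum>i<dim_vec v. (cmod (v $ i))\<^sup>2)"

definition spec_norm :: "nat \<Rightarrow> complex mat \<Rightarrow> real" where
  "spec_norm d M = Sup {vnorm (M *\<^sub>v v) | v. v \<in> carrier_vec d \<and> vnorm v = 1}"

definition unitary_mat :: "nat \<Rightarrow> complex mat \<Rightarrow> bool" where
  "unitary_mat d U \<longleftrightarrow> U \<in> carrier_mat d d \<and> mat_adjoint U * U = 1\<^sub>m d"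

definition unitary_rep :: "('a, 'b) monoid_scheme \<Rightarrow> nat \<Rightarrow> ('a \<Rightarrow> complex mat) \<Rightarrow> bool" where
  "unitary_rep G d \<rho> \<longleftrightarrow> (\<forall>g\<in>carrier G. unitary_mat d (\<rho> g)) \<and>
      (\<forall>g\<in>carrier G. \<forall>h\<in>carrier G. \<rho> (g \<otimes>\<^bsub>G\<^esub> h) = \<rho> g * \<rho> h)"

definition csubspace_vec :: "nat \<Rightarrow> complex vec set \<Rightarrow> bool" where
  "csubspace_vec d W \<longleftrightarrow> W \<subseteq> carrier_vec d \<and> 0\<^sub>v d \<in> W \<and>
      (\<forall>v\<in>W. \<forall>w\<in>W. v + w \<in> W) \<and> (\<forall>c. \<forall>v\<in>W. c \<cdot>\<^sub>v v \<in> W)"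

definition irreducible_rep :: "('a, 'b) monoid_scheme \<Rightarrow> nat \<Rightarrow> ('a \<Rightarrow> complex mat) \<Rightarrow> bool" where
  "irreducible_rep G d \<rho> \<longleftrightarrow> d > 0 \<and>
      (\<forall>W. csubspace_vec d W \<and> (\<forall>g\<in>carrier G. \<forall>w\<in>W. \<rho> g *\<^sub>v w \<in> W)
           \<longrightarrow> W = {0\<^sub>v d} \<or> W = carrier_vec d)"

definition nontrivial_rep :: "('a, 'b) monoid_scheme \<Rightarrow> nat \<Rightarrow> ('a \<Rightarrow> complex mat) \<Rightarrow> bool" where
  "nontrivial_rep G d \<rho> \<longleftrightarrow> (\<exists>g\<in>carrier G. \<rho> g \<noteq> 1\<^sub>m d)"

definition fourier_ind :: "'a set \<Rightarrow> nat \<Rightarrow> ('a \<Rightarrow> complex mat) \<Rightarrow> complex mat" where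
  "fourier_ind A d \<rho> = mat d d (\<lambda>(i, j). \<Sum>a\<in>A. \<rho> a $$ (i, j))"

text \<open>nu(A): maximum over nontrivial irreducible unitary representations (taken over all such
  representations, which gives the same value as over isomorphism classes); 0 if there are none.\<close>
definition nu :: "('a, 'b) monoid_scheme \<Rightarrow> 'a set \<Rightarrow> real" where
  "nu G A = Sup ({spec_norm d (fourier_ind A d \<rho>) | d \<rho>.
       unitary_rep G d \<rho> \<and> irreducible_rep G d \<rho> \<and> nontrivial_rep G d \<rho>} \<union> {0})"

end

theory Submission
  imports Defs "HOL-Analysis.L2_Norm" "HOL-Combinatorics.Multiset_Permutations"
    "Jordan_Normal_Form.Spectral_Radius"
begin

text \<open>For a (k-1)-cochain, expanding (L phi, phi) leaves |A| times the squared norm of phi and one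
  term for each (k-2)-simplex tau. The simplex tau misses two levels i < j; writing v and u for the
  values of phi on the extensions of tau to level i and to level j, the term is
    (sum v + sum u)^2 - 2 sum v(g) u(h)   with the last sum over all (g, h) with a g b h c in A,
  where a, b, c are products of vertex labels of tau. The constant parts of v and u contribute a
  nonnegative quantity because |A| is at most |G|. On the parts with zero sum, the bilinear form
  is, up to translations, the operator given by A in the regular representation restricted to the
  complement of the constants, so its norm is at most nu(A) by decomposing into irreducibles.
  Hence each term is at least -nu(A) (|v|^2 + |u|^2), and each (k-1)-simplex has k facets.\<close>

section \<open>The Fourier bound on the complement of the fixed vectors\<close>

text \<open>The labels of a simplex are multiplied in level order and G need not be commutative, so
  the sum over \<open>(g, h)\<close> is no convolution as it stands. Substituting for g an
  expression in the inverse of a new variable makes it one: once a and b cancel, the condition on h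
  is that it be a right translate of that variable by an element of A, up to the factor c. The
  regular representation is never split into irreducibles explicitly. The bound is proved for every
  unitary representation by induction on the dimension, along an invariant subspace and its
  orthogonal complement; squared norms add over the two, so the constant nu(A) does not grow. The
  square of sums comes from the lower part of the Laplacian. The upper part gives the mixed sum and
  |A|, because each (k-1)-simplex lies in exactly |A| k-simplices. Two points lie outside the
  estimate. The adjoint is given by a description, so its uniqueness has to be shown. The gap is a
  \<open>Min\<close>, so the set of eigenvalues has to be finite and nonempty. Both rest on an
  orthonormal basis of the cochains.\<close>

lemma mat_adjoint_index [simp]:
  fixes M :: "complex mat"
  assumes "i < dim_col M" "j < dim_row M"
  shows "mat_adjoint M $$ (i, j) = cnj (M $$ (j, i))"
  using assms by (simp add: mat_adjoint_def mat_of_rows_index)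

lemma mat_adjoint_dim [simp]:
  "dim_row (mat_adjoint M) = dim_col M" "dim_col (mat_adjoint M) = dim_row M"
  by (simp_all add: mat_adjoint_def)

lemma mat_adjoint_carrier [simp]: "M \<in> carrier_mat n m \<Longrightarrow> mat_adjoint M \<in> carrier_mat m n"
  by (intro carrier_matI) auto

lemma mat_adjoint_adjoint [simp]: "mat_adjoint (mat_adjoint M) = (M :: complex mat)"
  by (rule eq_matI) auto

lemma mat_adjoint_mult:
  fixes M N :: "complex mat"
  assumes "M \<in> carrier_mat n m" "N \<in> carrier_mat m l"
  shows "mat_adjoint (M * N) = mat_adjoint N * mat_adjoint M"
  using assms by (intro eq_matI) (auto simp: scalar_prod_def mult.commute intro!: sum.cong)

lemma cscalar_mult_mat_vec:
  fixes M :: "complex mat"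
  assumes "M \<in> carrier_mat n m" "x \<in> carrier_vec m" "y \<in> carrier_vec n"
  shows "(M *\<^sub>v x) \<bullet>c y = x \<bullet>c (mat_adjoint M *\<^sub>v y)"
proof -
  have eq: "conjugate (mat_adjoint M *\<^sub>v y) = M\<^sup>T *\<^sub>v conjugate y"
    using assms by (intro eq_vecI) (auto simp: scalar_prod_def intro!: sum.cong)
  have "(M *\<^sub>v x) \<bullet>c y = conjugate y \<bullet> (M *\<^sub>v x)"
    by (intro comm_scalar_prod[of _ n]) (use assms in auto)
  also have "\<dots> = (M\<^sup>T *\<^sub>v conjugate y) \<bullet> x"
    by (rule transpose_vec_mult_scalar[symmetric]) (use assms in auto)
  also have "\<dots> = x \<bullet> (M\<^sup>T *\<^sub>v conjugate y)"
    by (intro comm_scalar_prod[of _ m]) (use assms in auto)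
  finally show ?thesis by (simp add: eq)
qed

text \<open>The product \<open>\<bullet>c\<close> conjugates its second argument. Conjugating
  \<open>mat_adjoint M *\<^sub>v y\<close> leaves a plain transpose, to which the bilinear identity
  applies.\<close>

lemma cscalar_mult_mat_vec':
  fixes M :: "complex mat"
  assumes "M \<in> carrier_mat n m" "x \<in> carrier_vec m" "y \<in> carrier_vec n"
  shows "y \<bullet>c (M *\<^sub>v x) = (mat_adjoint M *\<^sub>v y) \<bullet>c x"
  using cscalar_mult_mat_vec[of "mat_adjoint M" m n y x] assms by simp

lemma vnorm_L2_set: "vnorm v = L2_set (\<lambda>i. cmod (v $ i)) {..<dim_vec v}"
  by (simp add: vnorm_def L2_set_def)

lemma vnorm_nonneg [simp]: "0 \<le> vnorm v"
  by (simp add: vnorm_def sum_nonneg)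

lemma cscalar_self: "v \<bullet>c v = complex_of_real ((vnorm v)\<^sup>2)"
proof -
  have "v \<bullet>c v = (\<Sum>i<dim_vec v. v $ i * cnj (v $ i))"
    by (simp add: scalar_prod_def atLeast0LessThan)
  then show ?thesis
    by (simp add: vnorm_def sum_nonneg flip: complex_norm_square)
qed

lemma vnorm_eq_0_iff: "v \<in> carrier_vec d \<Longrightarrow> vnorm v = 0 \<longleftrightarrow> v = 0\<^sub>v d"
  by (auto simp: vnorm_def sum_nonneg_eq_0_iff intro!: eq_vecI)

lemma cscalar_self_eq_0: "(v :: complex vec) \<in> carrier_vec d \<Longrightarrow> v \<bullet>c v = 0 \<Longrightarrow> v = 0\<^sub>v d"
  using vnorm_eq_0_iff[of v d] cscalar_self[of v] by simp

lemma vnorm_add_le: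
  assumes "v \<in> carrier_vec d" "w \<in> carrier_vec d"
  shows "vnorm (v + w) \<le> vnorm v + vnorm w"
proof -
  have "vnorm (v + w) = L2_set (\<lambda>i. cmod (v $ i + w $ i)) {..<d}"
    using assms unfolding vnorm_L2_set by (auto intro!: L2_set_cong)
  also have "\<dots> \<le> L2_set (\<lambda>i. cmod (v $ i) + cmod (w $ i)) {..<d}"
    by (intro L2_set_mono norm_triangle_ineq) auto
  also have "\<dots> \<le> vnorm v + vnorm w"
    using assms L2_set_triangle_ineq[of "\<lambda>i. cmod (v $ i)" "\<lambda>i. cmod (w $ i)" "{..<d}"]
    by (simp add: vnorm_L2_set)
  finally show ?thesis .
qed

lemma vnorm_smult: "vnorm (c \<cdot>\<^sub>v v) = cmod c * vnorm v"
  by (simp add: vnorm_def norm_mult power_mult_distrib real_sqrt_mult flip: sum_distrib_left)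

lemma eq_mat_on_vecI:
  fixes M N :: "complex mat"
  assumes M: "M \<in> carrier_mat n m" and N: "N \<in> carrier_mat n m"
    and eq: "\<And>x. x \<in> carrier_vec m \<Longrightarrow> M *\<^sub>v x = N *\<^sub>v x"
  shows "M = N"
proof (rule eq_matI)
  fix i j assume ij: "i < dim_row N" "j < dim_col N"
  have "(M *\<^sub>v unit_vec m j) $ i = (N *\<^sub>v unit_vec m j) $ i"
    using eq[of "unit_vec m j"] by simp
  then show "M $$ (i, j) = N $$ (i, j)"
    using ij M N by (simp add: scalar_prod_right_unit)
qed (use M N in auto)

section \<open>Orthonormal frames of subspaces\<close>

text \<open>One Gram-Schmidt step. An orthonormal system is stored as the columns of a matrix, so
  that the same matrix serves as an isometry from coordinates into the space; \<open>R\<close> has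
  \<open>q\<close> as an additional last column.\<close>

lemma isometry_extend:
  assumes Q: "Q \<in> carrier_mat d m" "mat_adjoint Q * Q = 1\<^sub>m m"
    and q: "q \<in> carrier_vec d" "mat_adjoint Q *\<^sub>v q = 0\<^sub>v m" "vnorm q = 1"
  defines "R \<equiv> mat d (Suc m) (\<lambda>(i, j). if j < m then Q $$ (i, j) else q $ i)"
  shows "mat_adjoint R * R = 1\<^sub>m (Suc m)"
    and "x \<in> carrier_vec (Suc m) \<Longrightarrow> R *\<^sub>v x = Q *\<^sub>v vec m (\<lambda>i. x $ i) + x $ m \<cdot>\<^sub>v q"
proof -
  have QQ: "(\<Sum>l = 0..<d. cnj (Q $$ (l, i)) * Q $$ (l, j)) = (if i = j then 1 else 0)"
    if "i < m" "j < m" for i j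
  proof -
    have "(mat_adjoint Q * Q) $$ (i, j) = (\<Sum>l = 0..<d. cnj (Q $$ (l, i)) * Q $$ (l, j))"
      using that Q(1) by (simp add: scalar_prod_def)
    then show ?thesis using Q(2) that by simp
  qed
  have Qq: "(\<Sum>l = 0..<d. cnj (Q $$ (l, i)) * q $ l) = 0" if "i < m" for i
  proof -
    have "(mat_adjoint Q *\<^sub>v q) $ i = (\<Sum>l = 0..<d. cnj (Q $$ (l, i)) * q $ l)"
      using that Q(1) q(1) by (simp add: scalar_prod_def)
    then show ?thesis using q(2) that by simp
  qed
  have qQ: "(\<Sum>l = 0..<d. cnj (q $ l) * Q $$ (l, i)) = 0" if "i < m" for i
  proof -
    have "(\<Sum>l = 0..<d. cnj (q $ l) * Q $$ (l, i)) = cnj (\<Sum>l = 0..<d. cnj (Q $$ (l, i)) * q $ l)"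
      by (simp add: mult.commute)
    then show ?thesis using Qq[OF that] by simp
  qed
  have qq: "(\<Sum>l = 0..<d. cnj (q $ l) * q $ l) = 1"
  proof -
    have "q \<bullet>c q = (\<Sum>l = 0..<d. cnj (q $ l) * q $ l)"
      using q(1) by (simp add: scalar_prod_def mult.commute)
    then show ?thesis using q(3) by (simp add: cscalar_self)
  qed
  show "mat_adjoint R * R = 1\<^sub>m (Suc m)"
  proof (rule eq_matI)
    fix i j assume "i < dim_row (1\<^sub>m (Suc m) :: complex mat)" "j < dim_col (1\<^sub>m (Suc m) :: complex mat)"
    then have ij: "i < Suc m" "j < Suc m" by auto
    have "(mat_adjoint R * R) $$ (i, j) =
        (\<Sum>l = 0..<d. cnj (R $$ (l, i)) * R $$ (l, j))"
      using ij by (simp add: scalar_prod_def R_def)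
    also have "\<dots> = (\<Sum>l = 0..<d. cnj (if i < m then Q $$ (l, i) else q $ l) *
        (if j < m then Q $$ (l, j) else q $ l))"
      using ij by (intro sum.cong) (auto simp: R_def)
    also have "\<dots> = (if i = j then 1 else 0)"
      using ij QQ Qq qQ qq by (cases "i < m"; cases "j < m") auto
    finally show "(mat_adjoint R * R) $$ (i, j) = 1\<^sub>m (Suc m) $$ (i, j)"
      using ij by simp
  qed (auto simp: R_def)
  show "R *\<^sub>v x = Q *\<^sub>v vec m (\<lambda>i. x $ i) + x $ m \<cdot>\<^sub>v q" if "x \<in> carrier_vec (Suc m)"
    using that Q q by (intro eq_vecI) (auto simp: R_def scalar_prod_def mult.commute intro!: sum.cong)
qed

text \<open>The columns of Q are a largest orthonormal system inside W; a vector of W not fixed by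
  the projection Q Q* would extend it by isometry_extend.\<close>

lemma csubspace_frame:
  assumes W: "csubspace_vec d W"
  obtains m Q where "m \<le> d" "Q \<in> carrier_mat d m" "mat_adjoint Q * Q = 1\<^sub>m m"
    "\<And>x. x \<in> carrier_vec m \<Longrightarrow> Q *\<^sub>v x \<in> W"
    "\<And>w. w \<in> W \<Longrightarrow> Q *\<^sub>v (mat_adjoint Q *\<^sub>v w) = w"
proof -
  have Wd: "w \<in> carrier_vec d" if "w \<in> W" for w
    using W that by (auto simp: csubspace_vec_def)
  have Wlin: "a + c \<cdot>\<^sub>v b \<in> W" if "a \<in> W" "b \<in> W" for a b c
    using W that by (auto simp: csubspace_vec_def)
  \<comment> \<open>The bound by d is built into \<open>P\<close> so that a greatest m exists. The
    price is that m = d has to be excluded separately before the system is extended.\<close>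
  define P where "P m \<longleftrightarrow> m \<le> d \<and> (\<exists>Q \<in> carrier_mat d m. mat_adjoint Q * Q = 1\<^sub>m m \<and>
      (\<forall>x \<in> carrier_vec m. Q *\<^sub>v x \<in> W))" for m
  have P0: "P 0"
    unfolding P_def
  proof (intro conjI bexI[of _ "0\<^sub>m d 0"] ballI)
    show "0\<^sub>m d 0 *\<^sub>v x \<in> W" if "x \<in> carrier_vec 0" for x
    proof -
      have "0\<^sub>m d 0 *\<^sub>v x = 0\<^sub>v d" using that by (intro eq_vecI) (auto simp: scalar_prod_def)
      then show ?thesis using W by (auto simp: csubspace_vec_def)
    qed
  qed (auto intro!: eq_matI)
  obtain m where m: "P m" "\<And>m'. P m' \<Longrightarrow> m' \<le> m"
  proof (rule that)
    have bd: "\<forall>y. P y \<longrightarrow> y \<le> d" by (simp add: P_def)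
    show "P (GREATEST m. P m)" using GreatestI_nat[of P 0 d] P0 bd by blast
    show "m' \<le> (GREATEST m. P m)" if "P m'" for m' using Greatest_le_nat[of P m' d] that bd by blast
  qed
  then obtain Q where Q: "Q \<in> carrier_mat d m" "mat_adjoint Q * Q = 1\<^sub>m m"
    "\<And>x. x \<in> carrier_vec m \<Longrightarrow> Q *\<^sub>v x \<in> W"
    unfolding P_def by blast
  have "Q *\<^sub>v (mat_adjoint Q *\<^sub>v w) = w" if w: "w \<in> W" for w
  proof (rule ccontr)
    assume neq: "Q *\<^sub>v (mat_adjoint Q *\<^sub>v w) \<noteq> w"
    let ?p = "Q *\<^sub>v (mat_adjoint Q *\<^sub>v w)"
    have wd: "w \<in> carrier_vec d" using Wd w by blast
    have ad: "mat_adjoint Q *\<^sub>v w \<in> carrier_vec m"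
      using Q(1) wd by (intro mult_mat_vec_carrier[of _ m d]) auto
    have pd: "?p \<in> carrier_vec d" by (rule mult_mat_vec_carrier[OF Q(1) ad])
    \<comment> \<open>For m = d the isometry is square, its left inverse is also a right inverse,
      and the projection would fix every vector, in particular w.\<close>
    have "m \<noteq> d"
    proof
      assume "m = d"
      then have "Q * mat_adjoint Q = 1\<^sub>m d"
        using Q mat_mult_left_right_inverse[of "mat_adjoint Q" d Q] by auto
      then have "?p = w"
        using Q(1) wd assoc_mult_mat_vec[of Q d m "mat_adjoint Q" d w] by simp
      with neq show False by simp
    qed
    with m(1) have md: "m < d" by (auto simp: P_def)
    define u where "u = w + (-1) \<cdot>\<^sub>v ?p"
    have uW: "u \<in> W"
      unfolding u_def by (intro Wlin w Q(3) ad)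
    have ud: "u \<in> carrier_vec d" using uW Wd by blast
    have "u \<noteq> 0\<^sub>v d"
    proof
      assume "u = 0\<^sub>v d"
      then have "u $ i = 0" if "i < d" for i using that by simp
      moreover have "u $ i = w $ i - ?p $ i" if "i < d" for i
        using that wd carrier_matD(1)[OF Q(1)] unfolding u_def by simp
      ultimately have "w $ i = ?p $ i" if "i < d" for i
        using that by simp
      then have "w = ?p" using wd carrier_matD(1)[OF Q(1)] by (intro eq_vecI) auto
      with neq show False by simp
    qed
    then have un: "vnorm u > 0" using ud vnorm_eq_0_iff[OF ud] vnorm_nonneg[of u] by linarith
    define q where "q = complex_of_real (1 / vnorm u) \<cdot>\<^sub>v u"
    have qd: "q \<in> carrier_vec d" using ud by (simp add: q_def)
    have Qp: "mat_adjoint Q *\<^sub>v ?p = mat_adjoint Q *\<^sub>v w"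
      using Q(1,2) ad by (simp flip: assoc_mult_mat_vec[of "mat_adjoint Q" m d Q m])
    have "mat_adjoint Q *\<^sub>v u = mat_adjoint Q *\<^sub>v w + (-1) \<cdot>\<^sub>v (mat_adjoint Q *\<^sub>v ?p)"
      unfolding u_def using Q(1) wd pd ad
      by (subst mult_add_distrib_mat_vec[of _ m d]) (auto simp: mult_mat_vec[of _ m d])
    also have "\<dots> = 0\<^sub>v m" unfolding Qp using carrier_matD(2)[OF Q(1)] by (intro eq_vecI) auto
    finally have "mat_adjoint Q *\<^sub>v q = 0\<^sub>v m"
      unfolding q_def using Q(1) ud by (auto simp: mult_mat_vec[of _ m d])
    moreover have "vnorm q = 1" using un by (simp add: q_def vnorm_smult norm_divide)
    ultimately have R: "mat_adjoint (mat d (Suc m) (\<lambda>(i, j). if j < m then Q $$ (i, j) else q $ i))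
          * mat d (Suc m) (\<lambda>(i, j). if j < m then Q $$ (i, j) else q $ i) = 1\<^sub>m (Suc m)"
      "\<And>x. x \<in> carrier_vec (Suc m) \<Longrightarrow>
        mat d (Suc m) (\<lambda>(i, j). if j < m then Q $$ (i, j) else q $ i) *\<^sub>v x
          = Q *\<^sub>v vec m (\<lambda>i. x $ i) + x $ m \<cdot>\<^sub>v q"
      using isometry_extend[OF Q(1,2) qd] by blast+
    have "q \<in> W"
      using W uW unfolding q_def csubspace_vec_def by blast
    have "P (Suc m)"
      unfolding P_def
    proof (intro conjI bexI[of _ "mat d (Suc m) (\<lambda>(i, j). if j < m then Q $$ (i, j) else q $ i)"]
        ballI R(1))
      show "mat d (Suc m) (\<lambda>(i, j). if j < m then Q $$ (i, j) else q $ i) *\<^sub>v x \<in> W"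
        if "x \<in> carrier_vec (Suc m)" for x
        unfolding R(2)[OF that] by (intro Wlin Q(3) \<open>q \<in> W\<close>) auto
    qed (use md in auto)
    with m(2) show False by fastforce
  qed
  then show thesis using that Q m(1) by (auto simp: P_def)
qed

lemma isometry_cscalar:
  fixes Q :: "complex mat"
  assumes "Q \<in> carrier_mat d m" "mat_adjoint Q * Q = 1\<^sub>m m" "x \<in> carrier_vec m"
  shows "mat_adjoint Q *\<^sub>v (Q *\<^sub>v x) = x"
  using assms by (simp flip: assoc_mult_mat_vec[of "mat_adjoint Q" m d Q m])

section \<open>Fourier matrices and the bound by \<open>nu\<close>\<close>

lemma fourier_ind_carrier [simp]: "fourier_ind A d \<rho> \<in> carrier_mat d d"
  by (simp add: fourier_ind_def)

lemma fourier_ind_empty: "fourier_ind {} d \<rho> = 0\<^sub>m d d"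
  by (auto simp: fourier_ind_def intro!: eq_matI)

lemma fourier_ind_insert:
  assumes "finite A" "a \<notin> A" "\<rho> a \<in> carrier_mat d d"
  shows "fourier_ind (insert a A) d \<rho> = \<rho> a + fourier_ind A d \<rho>"
  using assms by (auto simp: fourier_ind_def intro!: eq_matI)

lemma unitary_repD:
  assumes "unitary_rep G d \<rho>" "g \<in> carrier G"
  shows "\<rho> g \<in> carrier_mat d d" "mat_adjoint (\<rho> g) * \<rho> g = 1\<^sub>m d"
  using assms by (auto simp: unitary_rep_def unitary_mat_def)

lemma unitary_rep_mult:
  assumes "unitary_rep G d \<rho>" "g \<in> carrier G" "h \<in> carrier G"
  shows "\<rho> (g \<otimes>\<^bsub>G\<^esub> h) = \<rho> g * \<rho> h"
  using assms by (auto simp: unitary_rep_def)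

lemma unitary_rep_adjoint:
  assumes "group G" and \<rho>: "unitary_rep G d \<rho>" and g: "g \<in> carrier G"
  shows "mat_adjoint (\<rho> g) = \<rho> (inv\<^bsub>G\<^esub> g)"
proof -
  interpret group G by fact
  note D = unitary_repD[OF \<rho>]
  have ig: "inv\<^bsub>G\<^esub> g \<in> carrier G" using g by simp
  \<comment> \<open>That the unit is sent to the identity matrix follows from multiplicativity:
    \<open>\<rho> \<one>\<close> is an idempotent isometry, and cancelling one factor by its adjoint
    leaves the identity.\<close>
  have "\<rho> \<one>\<^bsub>G\<^esub> = mat_adjoint (\<rho> \<one>\<^bsub>G\<^esub>) * \<rho> \<one>\<^bsub>G\<^esub> * \<rho> \<one>\<^bsub>G\<^esub>"
    using D[OF one_closed] by simp
  also have "\<dots> = mat_adjoint (\<rho> \<one>\<^bsub>G\<^esub>) * \<rho> (\<one>\<^bsub>G\<^esub> \<otimes>\<^bsub>G\<^esub> \<one>\<^bsub>G\<^esub>)"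
    unfolding unitary_rep_mult[OF \<rho> one_closed one_closed]
    using D[OF one_closed] by (intro assoc_mult_mat[of _ d d _ d _ d]) auto
  also have "\<dots> = 1\<^sub>m d" using D[OF one_closed] by simp
  finally have 1: "\<rho> g * \<rho> (inv\<^bsub>G\<^esub> g) = 1\<^sub>m d"
    using unitary_rep_mult[OF \<rho> g ig] g by simp
  have "mat_adjoint (\<rho> g) = mat_adjoint (\<rho> g) * (\<rho> g * \<rho> (inv\<^bsub>G\<^esub> g))"
    unfolding 1 using D[OF g] by simp
  also have "\<dots> = (mat_adjoint (\<rho> g) * \<rho> g) * \<rho> (inv\<^bsub>G\<^esub> g)"
    using D[OF g] D[OF ig] by (intro assoc_mult_mat[symmetric, of _ d d _ d _ d]) auto
  also have "\<dots> = \<rho> (inv\<^bsub>G\<^esub> g)" using D[OF g] D[OF ig] by simp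
  finally show ?thesis .
qed

lemma vnorm_isometry:
  fixes Q :: "complex mat"
  assumes "Q \<in> carrier_mat d m" "mat_adjoint Q * Q = 1\<^sub>m m" "x \<in> carrier_vec m"
  shows "vnorm (Q *\<^sub>v x) = vnorm x"
proof -
  have "(Q *\<^sub>v x) \<bullet>c (Q *\<^sub>v x) = x \<bullet>c x"
    using cscalar_mult_mat_vec[of Q d m x "Q *\<^sub>v x"] isometry_cscalar[OF assms] assms by simp
  then have "(vnorm (Q *\<^sub>v x))\<^sup>2 = (vnorm x)\<^sup>2"
    unfolding cscalar_self using of_real_eq_iff by blast
  then show ?thesis by simp
qed

text \<open>The crude bound from the triangle inequality. It serves to show that the suprema in
  \<open>spec_norm\<close> and \<open>nu\<close> are taken over bounded sets, where
  \<open>Sup\<close> has its meaning.\<close>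

lemma vnorm_fourier_ind_le:
  assumes "finite A" "\<And>a. a \<in> A \<Longrightarrow> \<rho> a \<in> carrier_mat d d"
    "\<And>a. a \<in> A \<Longrightarrow> mat_adjoint (\<rho> a) * \<rho> a = 1\<^sub>m d" "v \<in> carrier_vec d"
  shows "vnorm (fourier_ind A d \<rho> *\<^sub>v v) \<le> real (card A) * vnorm v"
  using assms(1-3)
proof (induction A rule: finite_induct)
  case empty
  have "0\<^sub>m d d *\<^sub>v v = 0\<^sub>v d" using assms(4) by auto
  then show ?case using vnorm_eq_0_iff[of "0\<^sub>v d" d] by (simp add: fourier_ind_empty)
next
  case (insert a A)
  have "vnorm (fourier_ind (insert a A) d \<rho> *\<^sub>v v)
      = vnorm (\<rho> a *\<^sub>v v + fourier_ind A d \<rho> *\<^sub>v v)"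
    using insert assms(4) fourier_ind_carrier[of A d \<rho>]
    by (subst fourier_ind_insert) (auto simp: add_mult_distrib_mat_vec[of _ d d])
  also have "\<dots> \<le> vnorm (\<rho> a *\<^sub>v v) + vnorm (fourier_ind A d \<rho> *\<^sub>v v)"
    using insert assms(4) fourier_ind_carrier[of A d \<rho>] by (intro vnorm_add_le[of _ d] mult_mat_vec_carrier) auto
  also have "\<dots> \<le> vnorm v + real (card A) * vnorm v"
    using insert vnorm_isometry[of "\<rho> a" d d v] assms(4) by (intro add_mono) auto
  finally show ?case using insert by (simp add: algebra_simps)
qed

text \<open>Any a priori bound c makes the supremum over unit vectors meaningful. In dimension 0
  there is no unit vector and the supremum is over the empty set, hence the condition
  \<open>d > 0\<close> in the first claim. The second follows by scaling to norm 1.\<close>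

lemma spec_norm_bounds:
  assumes M: "M \<in> carrier_mat d d" and bd: "\<And>v. v \<in> carrier_vec d \<Longrightarrow> vnorm (M *\<^sub>v v) \<le> c * vnorm v"
  shows "d > 0 \<Longrightarrow> spec_norm d M \<le> c"
    and "v \<in> carrier_vec d \<Longrightarrow> vnorm (M *\<^sub>v v) \<le> spec_norm d M * vnorm v"
proof -
  let ?S = "{vnorm (M *\<^sub>v v) | v. v \<in> carrier_vec d \<and> vnorm v = 1}"
  have le: "s \<le> c" if "s \<in> ?S" for s
    using that bd by force
  then have bdd: "bdd_above ?S" by (rule bdd_aboveI)
  show "spec_norm d M \<le> c" if "d > 0"
  proof -
    have "vnorm (unit_vec d 0) = 1"
    proof -
      have "(\<Sum>i<d. (cmod (unit_vec d 0 $ i))\<^sup>2) = (\<Sum>i<d. if i = 0 then 1 else 0)"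
        by (intro sum.cong) (auto simp: unit_vec_def)
      then show ?thesis using that by (simp add: vnorm_def)
    qed
    then have "?S \<noteq> {}" by fastforce
    then show ?thesis unfolding spec_norm_def using le by (intro cSup_least) auto
  qed
  show "vnorm (M *\<^sub>v v) \<le> spec_norm d M * vnorm v" if v: "v \<in> carrier_vec d"
  proof (cases "vnorm v = 0")
    case True
    then show ?thesis using bd[OF v] by simp
  next
    case False
    then have pos: "vnorm v > 0" using vnorm_nonneg[of v] by linarith
    define u where "u = complex_of_real (1 / vnorm v) \<cdot>\<^sub>v v"
    have u: "u \<in> carrier_vec d" "vnorm u = 1" using v pos by (simp_all add: u_def vnorm_smult norm_divide)
    have "vnorm (M *\<^sub>v u) \<le> spec_norm d M"
      unfolding spec_norm_def using u by (intro cSup_upper bdd) auto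
    moreover have "vnorm (M *\<^sub>v u) = vnorm (M *\<^sub>v v) / vnorm v"
      using pos M v by (simp add: u_def mult_mat_vec[of _ d d] vnorm_smult norm_divide)
    ultimately show ?thesis using pos by (simp add: field_simps)
  qed
qed

text \<open>The bound |A| is uniform in the dimension, and irreducibility supplies the positive
  dimension that the bound on \<open>spec_norm\<close> asks for.\<close>

lemma nu_bdd:
  assumes "finite A" "A \<subseteq> carrier G"
  shows "bdd_above ({spec_norm d (fourier_ind A d \<rho>) | d \<rho>.
       unitary_rep G d \<rho> \<and> irreducible_rep G d \<rho> \<and> nontrivial_rep G d \<rho>} \<union> {0})"
proof (rule bdd_aboveI[of _ "real (card A)"])
  fix s assume "s \<in> {spec_norm d (fourier_ind A d \<rho>) | d \<rho>.
       unitary_rep G d \<rho> \<and> irreducible_rep G d \<rho> \<and> nontrivial_rep G d \<rho>} \<union> {0}"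
  then consider "s = 0" | d \<rho> where "s = spec_norm d (fourier_ind A d \<rho>)"
    "unitary_rep G d \<rho>" "d > 0"
    by (auto simp: irreducible_rep_def)
  then show "s \<le> real (card A)"
  proof cases
    case 2
    then show ?thesis
      using spec_norm_bounds(1)[of "fourier_ind A d \<rho>" d "real (card A)"]
        vnorm_fourier_ind_le[of A \<rho> d] unitary_repD[OF 2(2)] assms by (auto simp: subset_iff)
  qed simp
qed

lemma nu_nonneg:
  assumes "finite A" "A \<subseteq> carrier G"
  shows "0 \<le> nu G A"
  unfolding nu_def by (rule cSup_upper[OF _ nu_bdd[OF assms]]) simp

lemma vnorm_fourier_ind_le_nu:
  assumes A: "finite A" "A \<subseteq> carrier G"
    and \<rho>: "unitary_rep G d \<rho>" "irreducible_rep G d \<rho>" "nontrivial_rep G d \<rho>"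
    and v: "v \<in> carrier_vec d"
  shows "vnorm (fourier_ind A d \<rho> *\<^sub>v v) \<le> nu G A * vnorm v"
proof -
  have "vnorm (fourier_ind A d \<rho> *\<^sub>v v) \<le> spec_norm d (fourier_ind A d \<rho>) * vnorm v"
    using spec_norm_bounds(2)[of "fourier_ind A d \<rho>" d "real (card A)"] v
        vnorm_fourier_ind_le[of A \<rho> d] unitary_repD[OF \<rho>(1)] A by (auto simp: subset_iff)
  also have "\<dots> \<le> nu G A * vnorm v"
    unfolding nu_def
    by (intro mult_right_mono cSup_upper[OF _ nu_bdd[OF A]]) (use \<rho> in auto)
  finally show ?thesis .
qed

section \<open>Restriction to invariant subspaces and induction on the dimension\<close>

lemma compression_unitary_rep:
  assumes "group G" and \<rho>: "unitary_rep G d \<rho>"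
    and Q: "Q \<in> carrier_mat d m" "mat_adjoint Q * Q = 1\<^sub>m m"
    and inv: "\<And>g. g \<in> carrier G \<Longrightarrow> Q * (mat_adjoint Q * (\<rho> g * Q)) = \<rho> g * Q"
  shows "unitary_rep G m (\<lambda>g. mat_adjoint Q * (\<rho> g * Q))"
  unfolding unitary_rep_def
proof (intro conjI ballI)
  note D = unitary_repD[OF \<rho>]
  have Q': "mat_adjoint Q \<in> carrier_mat m d" using Q by simp
  show "unitary_mat m (mat_adjoint Q * (\<rho> g * Q))" if g: "g \<in> carrier G" for g
    unfolding unitary_mat_def
  proof
    show c: "mat_adjoint Q * (\<rho> g * Q) \<in> carrier_mat m m" using Q D[OF g] by auto
    have "mat_adjoint (mat_adjoint Q * (\<rho> g * Q)) * (mat_adjoint Q * (\<rho> g * Q))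
        = (mat_adjoint (\<rho> g * Q) * Q) * (mat_adjoint Q * (\<rho> g * Q))"
      using Q D[OF g] by (simp add: mat_adjoint_mult[of _ m d _ m])
    also have "\<dots> = mat_adjoint (\<rho> g * Q) * (\<rho> g * Q)"
      using Q D[OF g] c inv[OF g] by (subst assoc_mult_mat[of _ m d _ m _ m]) auto
    also have "\<dots> = mat_adjoint Q * (mat_adjoint (\<rho> g) * (\<rho> g * Q))"
      using Q D[OF g] by (simp add: mat_adjoint_mult[of _ d d _ m] assoc_mult_mat[of _ m d _ d _ m])
    also have "mat_adjoint (\<rho> g) * (\<rho> g * Q) = (mat_adjoint (\<rho> g) * \<rho> g) * Q"
      using Q D(1)[OF g] by (intro assoc_mult_mat[symmetric, of _ d d _ d _ m]) auto
    also have "\<dots> = Q" using Q D[OF g] by simp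
    finally show "mat_adjoint (mat_adjoint Q * (\<rho> g * Q)) * (mat_adjoint Q * (\<rho> g * Q)) = 1\<^sub>m m"
      using Q by simp
  qed
  fix g h assume g: "g \<in> carrier G" and h: "h \<in> carrier G"
  have "mat_adjoint Q * (\<rho> g * Q) * (mat_adjoint Q * (\<rho> h * Q))
      = mat_adjoint Q * ((\<rho> g * Q) * (mat_adjoint Q * (\<rho> h * Q)))"
    using Q D(1)[OF g] D(1)[OF h] by (intro assoc_mult_mat[of _ m d _ m _ m]) auto
  also have "(\<rho> g * Q) * (mat_adjoint Q * (\<rho> h * Q)) = \<rho> g * (Q * (mat_adjoint Q * (\<rho> h * Q)))"
    using Q D(1)[OF g] D(1)[OF h] by (intro assoc_mult_mat[of _ d d _ m _ m]) auto
  also have "\<dots> = (\<rho> g * \<rho> h) * Q"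
    unfolding inv[OF h] using Q D(1)[OF g] D(1)[OF h]
    by (intro assoc_mult_mat[symmetric, of _ d d _ d _ m]) auto
  finally show "mat_adjoint Q * (\<rho> (g \<otimes>\<^bsub>G\<^esub> h) * Q)
      = mat_adjoint Q * (\<rho> g * Q) * (mat_adjoint Q * (\<rho> h * Q))"
    unfolding unitary_rep_mult[OF \<rho> g h] by simp
qed

lemma compression_fourier_ind:
  assumes "finite A" and \<rho>: "\<And>g. g \<in> A \<Longrightarrow> \<rho> g \<in> carrier_mat d d"
    and Q: "Q \<in> carrier_mat d m"
    and inv: "\<And>g. g \<in> A \<Longrightarrow> Q * (mat_adjoint Q * (\<rho> g * Q)) = \<rho> g * Q"
  shows "fourier_ind A d \<rho> * Q = Q * fourier_ind A m (\<lambda>g. mat_adjoint Q * (\<rho> g * Q))"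
  using assms(1,2,4)
proof (induction A rule: finite_induct)
  case empty
  show ?case using Q by (simp add: fourier_ind_empty)
next
  case (insert a A)
  have c: "\<rho> a \<in> carrier_mat d d" "mat_adjoint Q * (\<rho> a * Q) \<in> carrier_mat m m"
    using insert Q by auto
  have "fourier_ind (insert a A) d \<rho> * Q = \<rho> a * Q + fourier_ind A d \<rho> * Q"
    using insert c Q by (subst fourier_ind_insert) (auto simp: add_mult_distrib_mat[of _ d d])
  also have "\<dots> = Q * (mat_adjoint Q * (\<rho> a * Q))
      + Q * fourier_ind A m (\<lambda>g. mat_adjoint Q * (\<rho> g * Q))"
    using insert by simp
  also have "\<dots> = Q * fourier_ind (insert a A) m (\<lambda>g. mat_adjoint Q * (\<rho> g * Q))"
    using insert c Q by (subst fourier_ind_insert) (auto simp: mult_add_distrib_mat[of _ d m])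
  finally show ?case .
qed

lemma vnorm_pythagoras:
  assumes "u \<in> carrier_vec d" "w \<in> carrier_vec d" "u \<bullet>c w = 0"
  shows "(vnorm (u + w))\<^sup>2 = (vnorm u)\<^sup>2 + (vnorm w)\<^sup>2"
proof -
  have "w \<bullet>c u = conjugate (u \<bullet>c w)"
    using assms by (metis conjugate_conjugate_sprod conjugate_vec_sprod_comm)
  then have wu: "w \<bullet>c u = 0" using assms(3) by simp
  have "conjugate (u + w) = conjugate u + conjugate w"
    using assms by (intro eq_vecI) auto
  then have "(u + w) \<bullet>c (u + w) = (u + w) \<bullet>c u + (u + w) \<bullet>c w"
    using assms by (simp add: scalar_prod_add_distrib[of _ d])
  also have "\<dots> = u \<bullet>c u + w \<bullet>c w"
    using assms wu by (simp add: add_scalar_prod_distrib[of _ d])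
  finally show ?thesis
    unfolding cscalar_self by (metis of_real_add of_real_eq_iff)
qed

text \<open>In the regular representation the fixed vectors are the constant functions, so there
  this is the condition of having sum zero.\<close>

definition orth_fixed :: "('a, 'b) monoid_scheme \<Rightarrow> nat \<Rightarrow> ('a \<Rightarrow> complex mat) \<Rightarrow> complex vec \<Rightarrow> bool" where
  "orth_fixed G d \<rho> v \<longleftrightarrow> v \<in> carrier_vec d \<and>
     (\<forall>w\<in>carrier_vec d. (\<forall>g\<in>carrier G. \<rho> g *\<^sub>v w = w) \<longrightarrow> v \<bullet>c w = 0)"

text \<open>Here p is the orthogonal projection of v to W, and the estimate is obtained in
  coordinates on W, where the dimension is smaller. The induction hypothesis is an assumption so
  that the argument can be used for an invariant subspace and for its orthogonal complement
  alike.\<close>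

lemma invariant_subspace_component:
  assumes "group G" and A: "finite A" "A \<subseteq> carrier G" and \<rho>: "unitary_rep G d \<rho>"
    and W: "csubspace_vec d W" "W \<noteq> carrier_vec d"
    and inv: "\<And>g w. g \<in> carrier G \<Longrightarrow> w \<in> W \<Longrightarrow> \<rho> g *\<^sub>v w \<in> W"
    and v: "orth_fixed G d \<rho> v"
    and IH: "\<And>m \<rho>' v'. m < d \<Longrightarrow> unitary_rep G m \<rho>' \<Longrightarrow> orth_fixed G m \<rho>' v' \<Longrightarrow>
      vnorm (fourier_ind A m \<rho>' *\<^sub>v v') \<le> c * vnorm v'"
  obtains p where "p \<in> W" "\<And>w. w \<in> W \<Longrightarrow> (v - p) \<bullet>c w = 0" "fourier_ind A d \<rho> *\<^sub>v p \<in> W"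
    "vnorm (fourier_ind A d \<rho> *\<^sub>v p) \<le> c * vnorm p"
proof -
  obtain m Q where m: "m \<le> d" and Q: "Q \<in> carrier_mat d m" "mat_adjoint Q * Q = 1\<^sub>m m"
    and QW: "\<And>x. x \<in> carrier_vec m \<Longrightarrow> Q *\<^sub>v x \<in> W"
    and WQ: "\<And>w. w \<in> W \<Longrightarrow> Q *\<^sub>v (mat_adjoint Q *\<^sub>v w) = w"
    using csubspace_frame[OF W(1)] by blast
  note D = unitary_repD[OF \<rho>]
  have Q': "mat_adjoint Q \<in> carrier_mat m d" using Q by simp
  have Wd: "w \<in> carrier_vec d" if "w \<in> W" for w
    using W that by (auto simp: csubspace_vec_def)
  have vd: "v \<in> carrier_vec d" using v by (simp add: orth_fixed_def)
  have "m \<noteq> d"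
  proof
    assume "m = d"
    then have QQ: "Q * mat_adjoint Q = 1\<^sub>m d"
      using Q mat_mult_left_right_inverse[of "mat_adjoint Q" d Q] by auto
    have "w \<in> W" if "w \<in> carrier_vec d" for w
      using QW[of "mat_adjoint Q *\<^sub>v w"] Q(1) Q' QQ that \<open>m = d\<close>
        assoc_mult_mat_vec[of Q d m "mat_adjoint Q" d w] mult_mat_vec_carrier[OF Q' that] by simp
    then show False using W Wd by blast
  qed
  with m have md: "m < d" by simp
  define \<rho>' where "\<rho>' g = mat_adjoint Q * (\<rho> g * Q)" for g
  have QQ: "Q * (mat_adjoint Q * (\<rho> g * Q)) = \<rho> g * Q" if g: "g \<in> carrier G" for g
  proof (rule eq_mat_on_vecI[of _ d m])
    fix x :: "complex vec" assume x: "x \<in> carrier_vec m"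
    have "Q * (mat_adjoint Q * (\<rho> g * Q)) *\<^sub>v x = Q *\<^sub>v (mat_adjoint Q *\<^sub>v (\<rho> g *\<^sub>v (Q *\<^sub>v x)))"
    proof -
      have 1: "\<rho> g * Q *\<^sub>v x = \<rho> g *\<^sub>v (Q *\<^sub>v x)"
        using Q D(1)[OF g] x by (intro assoc_mult_mat_vec) auto
      have 2: "mat_adjoint Q * (\<rho> g * Q) *\<^sub>v x = mat_adjoint Q *\<^sub>v (\<rho> g * Q *\<^sub>v x)"
        using Q' Q D(1)[OF g] x by (intro assoc_mult_mat_vec[of _ m d _ m]) auto
      have "Q * (mat_adjoint Q * (\<rho> g * Q)) *\<^sub>v x = Q *\<^sub>v (mat_adjoint Q * (\<rho> g * Q) *\<^sub>v x)"
        using Q' Q D(1)[OF g] x by (intro assoc_mult_mat_vec[of _ d m _ m]) auto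
      then show ?thesis by (simp only: 1 2)
    qed
    also have "\<dots> = \<rho> g *\<^sub>v (Q *\<^sub>v x)" by (intro WQ inv g QW x)
    also have "\<dots> = \<rho> g * Q *\<^sub>v x"
      using Q D(1)[OF g] x by (intro assoc_mult_mat_vec[symmetric]) auto
    finally show "Q * (mat_adjoint Q * (\<rho> g * Q)) *\<^sub>v x = \<rho> g * Q *\<^sub>v x" .
  qed (use Q Q' D(1)[OF g] in auto)
  have \<rho>'u: "unitary_rep G m \<rho>'"
    unfolding \<rho>'_def by (rule compression_unitary_rep) (use assms(1) \<rho> Q QQ in auto)
  have FQ: "fourier_ind A d \<rho> * Q = Q * fourier_ind A m \<rho>'"
    unfolding \<rho>'_def by (rule compression_fourier_ind) (use A D Q QQ in auto)
  define x where "x = mat_adjoint Q *\<^sub>v v"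
  have x: "x \<in> carrier_vec m" using Q' vd unfolding x_def by (rule mult_mat_vec_carrier)
  \<comment> \<open>A fixed vector w of the restriction gives a fixed vector
    \<open>Q *\<^sub>v w\<close> of \<rho>, and the product of x with w equals that of v with
    \<open>Q *\<^sub>v w\<close>.\<close>
  have ox: "orth_fixed G m \<rho>' x"
    unfolding orth_fixed_def
  proof (intro conjI x ballI impI)
    fix w :: "complex vec" assume w: "w \<in> carrier_vec m" and fixd: "\<forall>g\<in>carrier G. \<rho>' g *\<^sub>v w = w"
    have "\<rho> g *\<^sub>v (Q *\<^sub>v w) = Q *\<^sub>v w" if g: "g \<in> carrier G" for g
    proof -
      have "\<rho> g *\<^sub>v (Q *\<^sub>v w) = Q * \<rho>' g *\<^sub>v w"
        unfolding \<rho>'_def QQ[OF g] using Q D(1)[OF g] w by (intro assoc_mult_mat_vec[symmetric]) auto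
      also have "\<dots> = Q *\<^sub>v (\<rho>' g *\<^sub>v w)"
        using Q unitary_repD(1)[OF \<rho>'u g] w by (intro assoc_mult_mat_vec) auto
      finally show ?thesis using fixd g by simp
    qed
    then have "v \<bullet>c (Q *\<^sub>v w) = 0"
      using v QW[OF w] Wd by (auto simp: orth_fixed_def)
    then show "x \<bullet>c w = 0"
      unfolding x_def using cscalar_mult_mat_vec'[of Q d m w v] Q w vd by simp
  qed
  have Fx: "fourier_ind A m \<rho>' *\<^sub>v x \<in> carrier_vec m"
    by (rule mult_mat_vec_carrier[OF _ x]) simp
  have F: "fourier_ind A d \<rho> *\<^sub>v (Q *\<^sub>v x) = Q *\<^sub>v (fourier_ind A m \<rho>' *\<^sub>v x)"
  proof -
    have "fourier_ind A d \<rho> *\<^sub>v (Q *\<^sub>v x) = (fourier_ind A d \<rho> * Q) *\<^sub>v x"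
      using Q x by (intro assoc_mult_mat_vec[symmetric, of _ d d]) auto
    also have "\<dots> = Q *\<^sub>v (fourier_ind A m \<rho>' *\<^sub>v x)"
      unfolding FQ using Q x by (intro assoc_mult_mat_vec[of _ d m _ m]) auto
    finally show ?thesis .
  qed
  show thesis
  proof (rule that)
    show pW: "Q *\<^sub>v x \<in> W" by (rule QW[OF x])
    show "(v - Q *\<^sub>v x) \<bullet>c w = 0" if w: "w \<in> W" for w
    proof -
      have "(Q *\<^sub>v x) \<bullet>c w = x \<bullet>c (mat_adjoint Q *\<^sub>v w)"
        using Q x Wd[OF w] by (intro cscalar_mult_mat_vec) auto
      also have "\<dots> = v \<bullet>c (Q *\<^sub>v (mat_adjoint Q *\<^sub>v w))"
        unfolding x_def using Q vd Wd[OF w] mult_mat_vec_carrier[OF Q' Wd[OF w]]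
        by (intro cscalar_mult_mat_vec'[symmetric, of _ d m]) auto
      finally have "(Q *\<^sub>v x) \<bullet>c w = v \<bullet>c w" unfolding WQ[OF w] .
      then show ?thesis
        using vd Wd[OF pW] Wd[OF w] by (simp add: minus_scalar_prod_distrib[of _ d])
    qed
    show "fourier_ind A d \<rho> *\<^sub>v (Q *\<^sub>v x) \<in> W"
      unfolding F by (rule QW[OF Fx])
    show "vnorm (fourier_ind A d \<rho> *\<^sub>v (Q *\<^sub>v x)) \<le> c * vnorm (Q *\<^sub>v x)"
      unfolding F vnorm_isometry[OF Q Fx] vnorm_isometry[OF Q x] by (rule IH[OF md \<rho>'u ox])
  qed
qed

text \<open>Restricting to vectors orthogonal to the fixed vectors is what survives the induction:
  it passes to subrepresentations, and it excludes the trivial representation.\<close>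

lemma vnorm_fourier_ind_orth_fixed:
  assumes "group G" and A: "finite A" "A \<subseteq> carrier G"
    and "unitary_rep G d \<rho>" and "orth_fixed G d \<rho> v"
  shows "vnorm (fourier_ind A d \<rho> *\<^sub>v v) \<le> nu G A * vnorm v"
  using assms(4,5)
proof (induction d arbitrary: \<rho> v rule: less_induct)
  case (less d)
  interpret group G by fact
  note \<rho> = less.prems(1)
  note D = unitary_repD[OF \<rho>]
  have vd: "v \<in> carrier_vec d" using less.prems(2) by (simp add: orth_fixed_def)
  have zero: ?case if "v = 0\<^sub>v d"
  proof -
    have "fourier_ind A d \<rho> *\<^sub>v 0\<^sub>v d = 0\<^sub>v d"
      using fourier_ind_carrier[of A d \<rho>] by (intro eq_vecI) (auto simp del: fourier_ind_carrier)
    then show ?thesis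
      using that vnorm_eq_0_iff[of "0\<^sub>v d" d] by simp
  qed
  consider "d = 0" | "irreducible_rep G d \<rho>" "nontrivial_rep G d \<rho>"
    | "irreducible_rep G d \<rho>" "\<not> nontrivial_rep G d \<rho>"
    | "d > 0" "\<not> irreducible_rep G d \<rho>" by blast
  then show ?case
  proof cases
    case 1
    then show ?thesis using vd by (intro zero) (auto intro!: eq_vecI)
  next
    case 2
    then show ?thesis by (intro vnorm_fourier_ind_le_nu A \<rho> vd)
  next
    case 3
    \<comment> \<open>A trivial representation fixes v, so v is orthogonal to itself. This is the
      case that \<open>nu\<close> does not control.\<close>
    then have "\<rho> g *\<^sub>v v = v" if "g \<in> carrier G" for g
      using that vd by (auto simp: nontrivial_rep_def)
    then have "v \<bullet>c v = 0" using less.prems(2) vd by (auto simp: orth_fixed_def)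
    then show ?thesis by (intro zero cscalar_self_eq_0 vd)
  next
    case 4
    then obtain W where W: "csubspace_vec d W" "W \<noteq> {0\<^sub>v d}" "W \<noteq> carrier_vec d"
      and inv: "\<And>g w. g \<in> carrier G \<Longrightarrow> w \<in> W \<Longrightarrow> \<rho> g *\<^sub>v w \<in> W"
      by (auto simp: irreducible_rep_def)
    have Wd: "w \<in> carrier_vec d" if "w \<in> W" for w
      using W that by (auto simp: csubspace_vec_def)
    define V where "V = {u \<in> carrier_vec d. \<forall>w\<in>W. u \<bullet>c w = 0}"
    have V: "csubspace_vec d V"
      unfolding csubspace_vec_def V_def
      by (auto simp: Wd add_scalar_prod_distrib[of _ d])
    have Vne: "V \<noteq> carrier_vec d"
    proof
      assume VV: "V = carrier_vec d"
      have "w = 0\<^sub>v d" if "w \<in> W" for w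
      proof (rule cscalar_self_eq_0[OF Wd[OF that]])
        have "w \<in> V" using Wd[OF that] VV by simp
        then show "w \<bullet>c w = 0" using that by (simp add: V_def)
      qed
      moreover have "0\<^sub>v d \<in> W" using W by (auto simp: csubspace_vec_def)
      ultimately show False using W(2) by blast
    qed
    \<comment> \<open>Moved to the other side of the product, \<open>\<rho> g\<close> becomes its
      adjoint, which is \<rho> at the inverse of g and therefore preserves W.\<close>
    have Vinv: "\<rho> g *\<^sub>v u \<in> V" if g: "g \<in> carrier G" and u: "u \<in> V" for g u
      unfolding V_def
    proof (intro CollectI conjI ballI)
      have ud: "u \<in> carrier_vec d" using u by (simp add: V_def)
      show "\<rho> g *\<^sub>v u \<in> carrier_vec d" by (rule mult_mat_vec_carrier[OF D(1)[OF g] ud])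
      show "(\<rho> g *\<^sub>v u) \<bullet>c w = 0" if w: "w \<in> W" for w
        using cscalar_mult_mat_vec[OF D(1)[OF g] ud Wd[OF w]] u inv[of "inv\<^bsub>G\<^esub> g", OF _ w] g
        by (simp add: unitary_rep_adjoint[OF assms(1) \<rho> g] V_def)
    qed
    note component = invariant_subspace_component[OF assms(1) A \<rho> _ _ _ less.prems(2), where c = "nu G A"]
    obtain q where q: "q \<in> V" "\<And>w. w \<in> V \<Longrightarrow> (v - q) \<bullet>c w = 0"
      "fourier_ind A d \<rho> *\<^sub>v q \<in> V" "vnorm (fourier_ind A d \<rho> *\<^sub>v q) \<le> nu G A * vnorm q"
      by (rule component[of V]) (use that V Vne Vinv less.IH in blast)+
    obtain p where p: "p \<in> W" "\<And>w. w \<in> W \<Longrightarrow> (v - p) \<bullet>c w = 0"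
      "fourier_ind A d \<rho> *\<^sub>v p \<in> W" "vnorm (fourier_ind A d \<rho> *\<^sub>v p) \<le> nu G A * vnorm p"
      by (rule component[of W]) (use that W inv less.IH in blast)+
    have pd: "p \<in> carrier_vec d" and qd: "q \<in> carrier_vec d"
      using p(1) q(1) Wd by (auto simp: V_def)
    \<comment> \<open>The defect of the decomposition. It is orthogonal to W by the choice of p,
      thus lies in V, and it is orthogonal to V by the choice of q; so it is orthogonal to
      itself.\<close>
    define r where "r = v - p - q"
    have rd: "r \<in> carrier_vec d" using vd pd qd by (simp add: r_def)
    have "r \<in> V"
      unfolding V_def
    proof (intro CollectI conjI rd ballI)
      show "r \<bullet>c w = 0" if w: "w \<in> W" for w
        using p(2)[OF w] q(1) w Wd[OF w] vd pd qd
        by (simp add: r_def V_def minus_scalar_prod_distrib[of _ d])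
    qed
    have "conjugate (r \<bullet>c p) = p \<bullet>c r"
      using rd pd by (metis conjugate_conjugate_sprod conjugate_vec_sprod_comm)
    then have pr: "p \<bullet>c r = 0" using \<open>r \<in> V\<close> p(1) by (simp add: V_def)
    have "r = (v - q) - p" unfolding r_def using vd pd qd by (intro eq_vecI) auto
    then have "r \<bullet>c r = (v - q) \<bullet>c r - p \<bullet>c r"
      using vd pd qd rd minus_scalar_prod_distrib[of "v - q" d p "conjugate r"] by simp
    then have "r = 0\<^sub>v d" using q(2)[OF \<open>r \<in> V\<close>] pr by (intro cscalar_self_eq_0 rd) simp
    then have "r $ i = 0" if "i < d" for i using that by simp
    then have veq: "v = q + p"
      using vd pd qd by (intro eq_vecI) (auto simp: r_def algebra_simps)
    \<comment> \<open>Both v and its image split orthogonally along V and W, so the squared bounds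
      of the two components add up with one and the same constant.\<close>
    have "(vnorm (fourier_ind A d \<rho> *\<^sub>v v))\<^sup>2
        = (vnorm (fourier_ind A d \<rho> *\<^sub>v q + fourier_ind A d \<rho> *\<^sub>v p))\<^sup>2"
      using pd qd by (simp add: veq mult_add_distrib_mat_vec[of _ d d])
    also have "\<dots> = (vnorm (fourier_ind A d \<rho> *\<^sub>v q))\<^sup>2 + (vnorm (fourier_ind A d \<rho> *\<^sub>v p))\<^sup>2"
      using q(3) p(3) Wd by (intro vnorm_pythagoras[of _ d]) (auto simp: V_def)
    also have "\<dots> \<le> (nu G A * vnorm q)\<^sup>2 + (nu G A * vnorm p)\<^sup>2"
      by (intro add_mono power_mono q p) auto
    also have "\<dots> = (nu G A)\<^sup>2 * (vnorm v)\<^sup>2"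
      unfolding veq using q(1) p(1) pd qd
      by (subst vnorm_pythagoras[of _ d]) (auto simp: V_def power_mult_distrib distrib_left)
    finally have "(vnorm (fourier_ind A d \<rho> *\<^sub>v v))\<^sup>2 \<le> (nu G A * vnorm v)\<^sup>2"
      by (simp add: power_mult_distrib)
    then show ?thesis
      by (rule power2_le_imp_le) (simp add: nu_nonneg[OF A])
  qed
qed

section \<open>The right regular representation\<close>

text \<open>Functions on G become vectors through the numbering f, and g acts by right translation
  of the argument. \<open>r g\<close> is the induced permutation of the indices. It reverses
  products, and pulling back along it reverses them again, so \<rho> is a homomorphism.\<close>

lemma regular_rep:
  assumes "group G" and fin: "finite (carrier G)"
  obtains n f \<rho> where "bij_betw f {0..<n} (carrier G)" "unitary_rep G n \<rho>"
    "\<And>g u i. g \<in> carrier G \<Longrightarrow> i < n \<Longrightarrow> (\<rho> g *\<^sub>v vec n (\<lambda>j. u (f j))) $ i = u (f i \<otimes>\<^bsub>G\<^esub> g)"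
proof -
  interpret group G by fact
  define n where "n = card (carrier G)"
  obtain f where f: "bij_betw f {0..<n} (carrier G)"
    using ex_bij_betw_nat_finite[OF fin] n_def by blast
  have fG: "f i \<in> carrier G" if "i < n" for i
    using bij_betwE[OF f] that by simp
  define r where "r g i = inv_into {0..<n} f (f i \<otimes>\<^bsub>G\<^esub> g)" for g i
  have r: "r g i < n" "f (r g i) = f i \<otimes>\<^bsub>G\<^esub> g" if "g \<in> carrier G" "i < n" for g i
  proof -
    have "f i \<otimes>\<^bsub>G\<^esub> g \<in> f ` {0..<n}" using fG that f by (simp add: bij_betw_def)
    then show "r g i < n" "f (r g i) = f i \<otimes>\<^bsub>G\<^esub> g"
      unfolding r_def using inv_into_into[of _ f "{0..<n}"] by (auto intro: f_inv_into_f)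
  qed
  have finj: "i = j" if "f i = f j" "i < n" "j < n" for i j
    using f that by (auto simp: bij_betw_def inj_on_def)
  have rmult: "r (g \<otimes>\<^bsub>G\<^esub> h) i = r h (r g i)" if "g \<in> carrier G" "h \<in> carrier G" "i < n" for g h i
    using that r fG by (intro finj) (auto simp: m_assoc)
  have rinv: "l = r (inv\<^bsub>G\<^esub> g) i \<longleftrightarrow> i = r g l" if "g \<in> carrier G" "i < n" "l < n" for g i l
  proof -
    have "r (inv\<^bsub>G\<^esub> g) (r g l) = l" "r g (r (inv\<^bsub>G\<^esub> g) i) = i"
      using that r fG by (auto intro!: finj simp: m_assoc)
    then show ?thesis by auto
  qed
  define \<rho> where "\<rho> g = mat n n (\<lambda>(i, j). if j = r g i then 1 else 0 :: complex)" for g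
  have "unitary_rep G n \<rho>"
    unfolding unitary_rep_def unitary_mat_def
  proof (intro conjI ballI)
    show "\<rho> g \<in> carrier_mat n n" for g by (simp add: \<rho>_def)
    show "mat_adjoint (\<rho> g) * \<rho> g = 1\<^sub>m n" if g: "g \<in> carrier G" for g
    proof (rule eq_matI)
      fix i j assume "i < dim_row (1\<^sub>m n :: complex mat)" "j < dim_col (1\<^sub>m n :: complex mat)"
      then have ij: "i < n" "j < n" by auto
      have "(mat_adjoint (\<rho> g) * \<rho> g) $$ (i, j)
          = (\<Sum>l = 0..<n. cnj (if i = r g l then 1 else 0) * (if j = r g l then 1 else 0))"
        using ij by (simp add: scalar_prod_def \<rho>_def)
      also have "\<dots> = (\<Sum>l = 0..<n. if l = r (inv\<^bsub>G\<^esub> g) i then (if i = j then 1 else 0) else 0)"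
        using ij rinv[OF g] by (intro sum.cong refl) auto
      also have "\<dots> = (if i = j then 1 else 0)"
        using r(1)[of "inv\<^bsub>G\<^esub> g" i] ij g by simp
      finally show "(mat_adjoint (\<rho> g) * \<rho> g) $$ (i, j) = 1\<^sub>m n $$ (i, j)" using ij by simp
    qed (auto simp: \<rho>_def)
    show "\<rho> (g \<otimes>\<^bsub>G\<^esub> h) = \<rho> g * \<rho> h" if gh: "g \<in> carrier G" "h \<in> carrier G" for g h
    proof (rule eq_matI)
      fix i j assume "i < dim_row (\<rho> g * \<rho> h)" "j < dim_col (\<rho> g * \<rho> h)"
      then have ij: "i < n" "j < n" by (auto simp: \<rho>_def)
      have "(\<rho> g * \<rho> h) $$ (i, j)
          = (\<Sum>l = 0..<n. (if l = r g i then 1 else 0) * (if j = r h l then 1 else 0))"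
        using ij by (simp add: scalar_prod_def \<rho>_def)
      also have "\<dots> = (\<Sum>l = 0..<n. if l = r g i then (if j = r h (r g i) then 1 else 0) else 0)"
        by (intro sum.cong refl) auto
      also have "\<dots> = (if j = r (g \<otimes>\<^bsub>G\<^esub> h) i then 1 else 0)"
        using r(1)[OF gh(1) ij(1)] rmult[OF gh ij(1)] by simp
      finally show "\<rho> (g \<otimes>\<^bsub>G\<^esub> h) $$ (i, j) = (\<rho> g * \<rho> h) $$ (i, j)"
        using ij by (simp add: \<rho>_def)
    qed (auto simp: \<rho>_def)
  qed
  moreover have "(\<rho> g *\<^sub>v vec n (\<lambda>j. u (f j))) $ i = u (f i \<otimes>\<^bsub>G\<^esub> g)"
    if "g \<in> carrier G" "i < n" for g u i
  proof -
    have "(\<rho> g *\<^sub>v vec n (\<lambda>j. u (f j))) $ i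
        = (\<Sum>j = 0..<n. (if j = r g i then 1 else 0) * u (f j))"
      using that by (simp add: \<rho>_def scalar_prod_def)
    also have "\<dots> = (\<Sum>j = 0..<n. if j = r g i then u (f j) else 0)"
      by (intro sum.cong) auto
    also have "\<dots> = u (f i \<otimes>\<^bsub>G\<^esub> g)" using r[OF that] by simp
    finally show ?thesis .
  qed
  ultimately show thesis using that f by blast
qed

lemma fourier_ind_mult_vec:
  assumes "finite A" "\<And>a. a \<in> A \<Longrightarrow> \<rho> a \<in> carrier_mat d d" "v \<in> carrier_vec d" "i < d"
  shows "(fourier_ind A d \<rho> *\<^sub>v v) $ i = (\<Sum>a\<in>A. (\<rho> a *\<^sub>v v) $ i)"
  using assms(1,2)
proof (induction A rule: finite_induct)
  case empty
  then show ?case using assms by (simp add: fourier_ind_empty)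
next
  case (insert a A)
  have "(fourier_ind (insert a A) d \<rho> *\<^sub>v v) = \<rho> a *\<^sub>v v + fourier_ind A d \<rho> *\<^sub>v v"
    using insert assms by (subst fourier_ind_insert) (auto simp: add_mult_distrib_mat_vec[of _ d d])
  moreover have "dim_vec (fourier_ind A d \<rho> *\<^sub>v v) = d" by (simp add: fourier_ind_def)
  ultimately show ?case using insert assms(4) by simp
qed

text \<open>The inner sum is the Fourier matrix of A in the regular representation, applied to u.
  Sum zero makes u orthogonal to the fixed vectors, so \<open>nu\<close> bounds its norm, and
  Cauchy-Schwarz bounds the pairing with v.\<close>

lemma translate_sum_bound:
  fixes u v :: "'a \<Rightarrow> real"
  assumes "group G" and fin: "finite (carrier G)" and A: "A \<subseteq> carrier G"
    and u: "(\<Sum>g\<in>carrier G. u g) = 0"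
  shows "\<bar>\<Sum>g\<in>carrier G. v g * (\<Sum>a\<in>A. u (g \<otimes>\<^bsub>G\<^esub> a))\<bar>
    \<le> nu G A * L2_set v (carrier G) * L2_set u (carrier G)"
proof -
  interpret group G by fact
  have finA: "finite A" using A fin finite_subset by blast
  obtain n f \<rho> where f: "bij_betw f {0..<n} (carrier G)" and \<rho>: "unitary_rep G n \<rho>"
    and act: "\<And>g (u :: 'a \<Rightarrow> complex) i. g \<in> carrier G \<Longrightarrow> i < n \<Longrightarrow>
        (\<rho> g *\<^sub>v vec n (\<lambda>j. u (f j))) $ i = u (f i \<otimes>\<^bsub>G\<^esub> g)"
    using regular_rep[OF assms(1) fin] by metis
  have fG: "f i \<in> carrier G" if "i < n" for i
    using bij_betwE[OF f] that by simp
  have sum_f: "(\<Sum>g\<in>carrier G. F g) = (\<Sum>i = 0..<n. F (f i))" for F :: "'a \<Rightarrow> 'c::comm_monoid_add"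
    using sum.reindex_bij_betw[OF f, of F] by simp
  define U where "U = vec n (\<lambda>j. complex_of_real (u (f j)))"
  have Ud: "U \<in> carrier_vec n" by (simp add: U_def)
  have "orth_fixed G n \<rho> U"
    unfolding orth_fixed_def
  proof (intro conjI Ud ballI impI)
    fix w :: "complex vec" assume w: "w \<in> carrier_vec n" and fixd: "\<forall>g\<in>carrier G. \<rho> g *\<^sub>v w = w"
    define z where "z g = w $ inv_into {0..<n} f g" for g
    have zf: "z (f j) = w $ j" if "j < n" for j
      using f that by (simp add: z_def bij_betw_def)
    have wz: "w = vec n (\<lambda>j. z (f j))"
      using w by (intro eq_vecI) (auto simp: zf)
    \<comment> \<open>Translating by the inverse of \<open>f i\<close> carries the point
      \<open>f i\<close> to the unit, so a fixed vector has everywhere the value it has at the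
      unit.\<close>
    have "w $ i = z \<one>\<^bsub>G\<^esub>" if i: "i < n" for i
    proof -
      have "z (f i \<otimes>\<^bsub>G\<^esub> inv\<^bsub>G\<^esub> f i) = (\<rho> (inv\<^bsub>G\<^esub> f i) *\<^sub>v w) $ i"
        unfolding wz using act[of "inv\<^bsub>G\<^esub> f i" i z] fG[OF i] i by simp
      then show ?thesis using fixd fG[OF i] by simp
    qed
    then have "U \<bullet>c w = (\<Sum>i = 0..<n. complex_of_real (u (f i))) * cnj (z \<one>\<^bsub>G\<^esub>)"
      using w by (simp add: scalar_prod_def U_def sum_distrib_right)
    also have "\<dots> = 0"
      using u by (simp add: sum_f flip: of_real_sum)
    finally show "U \<bullet>c w = 0" .
  qed
  then have "vnorm (fourier_ind A n \<rho> *\<^sub>v U) \<le> nu G A * vnorm U"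
    by (intro vnorm_fourier_ind_orth_fixed assms finA \<rho>)
  also have "vnorm U = L2_set u (carrier G)"
    by (simp add: vnorm_def L2_set_def U_def sum_f atLeast0LessThan)
  also have "vnorm (fourier_ind A n \<rho> *\<^sub>v U) = L2_set (\<lambda>g. \<Sum>a\<in>A. u (g \<otimes>\<^bsub>G\<^esub> a)) (carrier G)"
  proof -
    have "(fourier_ind A n \<rho> *\<^sub>v U) $ i = complex_of_real (\<Sum>a\<in>A. u (f i \<otimes>\<^bsub>G\<^esub> a))" if "i < n" for i
    proof -
      have "(fourier_ind A n \<rho> *\<^sub>v U) $ i = (\<Sum>a\<in>A. (\<rho> a *\<^sub>v U) $ i)"
        using A unitary_repD(1)[OF \<rho>] that by (intro fourier_ind_mult_vec finA Ud) auto
      also have "\<dots> = (\<Sum>a\<in>A. complex_of_real (u (f i \<otimes>\<^bsub>G\<^esub> a)))"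
        unfolding U_def using A that by (intro sum.cong refl act) auto
      finally show ?thesis by simp
    qed
    moreover have "dim_vec (fourier_ind A n \<rho> *\<^sub>v U) = n" by (simp add: fourier_ind_def)
    ultimately show ?thesis
      by (simp add: vnorm_def L2_set_def sum_f atLeast0LessThan del: of_real_sum)
  qed
  finally have le: "L2_set (\<lambda>g. \<Sum>a\<in>A. u (g \<otimes>\<^bsub>G\<^esub> a)) (carrier G) \<le> nu G A * L2_set u (carrier G)" .
  have "\<bar>\<Sum>g\<in>carrier G. v g * (\<Sum>a\<in>A. u (g \<otimes>\<^bsub>G\<^esub> a))\<bar>
      \<le> (\<Sum>g\<in>carrier G. \<bar>v g\<bar> * \<bar>\<Sum>a\<in>A. u (g \<otimes>\<^bsub>G\<^esub> a)\<bar>)"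
    by (rule order_trans[OF sum_abs]) (simp add: abs_mult)
  also have "\<dots> \<le> L2_set v (carrier G) * L2_set (\<lambda>g. \<Sum>a\<in>A. u (g \<otimes>\<^bsub>G\<^esub> a)) (carrier G)"
    by (rule L2_set_mult_ineq)
  also have "\<dots> \<le> L2_set v (carrier G) * (nu G A * L2_set u (carrier G))"
    by (intro mult_left_mono le) simp
  finally show ?thesis by (simp add: mult_ac)
qed

section \<open>The bilinear form of a link\<close>

text \<open>With g = \<open>s x\<close> the product a g b h c collapses to the inverse of x times h
  c. It equals y in A exactly when h = x y times the inverse of c, that is h =
  \<open>t (x y)\<close>. Both s and t permute G, so neither the norms nor the sum of u change, and
  \<open>translate_sum_bound\<close> applies.\<close>

lemma incidence_form_bound:
  fixes u v :: "'a \<Rightarrow> real"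
  assumes "group G" and fin: "finite (carrier G)" and A: "A \<subseteq> carrier G"
    and abc: "a \<in> carrier G" "b \<in> carrier G" "c \<in> carrier G"
    and u: "(\<Sum>g\<in>carrier G. u g) = 0"
  shows "\<bar>\<Sum>g\<in>carrier G. v g * (\<Sum>h | h \<in> carrier G \<and> a \<otimes>\<^bsub>G\<^esub> (g \<otimes>\<^bsub>G\<^esub> (b \<otimes>\<^bsub>G\<^esub> (h \<otimes>\<^bsub>G\<^esub> c))) \<in> A. u h)\<bar>
    \<le> nu G A * L2_set v (carrier G) * L2_set u (carrier G)"
proof -
  interpret group G by fact
  define s where "s x = inv\<^bsub>G\<^esub> a \<otimes>\<^bsub>G\<^esub> (inv\<^bsub>G\<^esub> x \<otimes>\<^bsub>G\<^esub> inv\<^bsub>G\<^esub> b)" for x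
  define t where "t x = x \<otimes>\<^bsub>G\<^esub> inv\<^bsub>G\<^esub> c" for x
  have s: "bij_betw s (carrier G) (carrier G)"
    by (rule bij_betw_byWitness[where f' = "\<lambda>g. inv\<^bsub>G\<^esub> (a \<otimes>\<^bsub>G\<^esub> (g \<otimes>\<^bsub>G\<^esub> b))"])
      (use abc in \<open>auto simp: s_def m_assoc inv_mult_group, simp_all flip: m_assoc\<close>)
  have t: "bij_betw t (carrier G) (carrier G)"
    by (rule bij_betw_byWitness[where f' = "\<lambda>g. g \<otimes>\<^bsub>G\<^esub> c"])
      (use abc in \<open>auto simp: t_def m_assoc\<close>)
  have L2: "L2_set (\<lambda>x. w (r x)) (carrier G) = L2_set w (carrier G)"
    if "bij_betw r (carrier G) (carrier G)" for r :: "'a \<Rightarrow> 'a" and w :: "'a \<Rightarrow> real"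
    using sum.reindex_bij_betw[OF that, of "\<lambda>x. (w x)\<^sup>2"] by (simp add: L2_set_def)
  have inner: "(\<Sum>h | h \<in> carrier G \<and> a \<otimes>\<^bsub>G\<^esub> (s x \<otimes>\<^bsub>G\<^esub> (b \<otimes>\<^bsub>G\<^esub> (h \<otimes>\<^bsub>G\<^esub> c))) \<in> A. u h)
      = (\<Sum>y\<in>A. u (t (x \<otimes>\<^bsub>G\<^esub> y)))" if x: "x \<in> carrier G" for x
  proof (rule sum.reindex_bij_betw[symmetric, of "\<lambda>y. t (x \<otimes>\<^bsub>G\<^esub> y)"])
    have eq: "a \<otimes>\<^bsub>G\<^esub> (s x \<otimes>\<^bsub>G\<^esub> (b \<otimes>\<^bsub>G\<^esub> (h \<otimes>\<^bsub>G\<^esub> c))) = inv\<^bsub>G\<^esub> x \<otimes>\<^bsub>G\<^esub> (h \<otimes>\<^bsub>G\<^esub> c)"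
      if h: "h \<in> carrier G" for h
    proof -
      have "a \<otimes>\<^bsub>G\<^esub> (s x \<otimes>\<^bsub>G\<^esub> (b \<otimes>\<^bsub>G\<^esub> (h \<otimes>\<^bsub>G\<^esub> c)))
          = (a \<otimes>\<^bsub>G\<^esub> inv\<^bsub>G\<^esub> a) \<otimes>\<^bsub>G\<^esub> (inv\<^bsub>G\<^esub> x \<otimes>\<^bsub>G\<^esub> ((inv\<^bsub>G\<^esub> b \<otimes>\<^bsub>G\<^esub> b) \<otimes>\<^bsub>G\<^esub> (h \<otimes>\<^bsub>G\<^esub> c)))"
        using abc x h by (simp only: s_def m_assoc inv_closed m_closed)
      then show ?thesis using abc x h by simp
    qed
    have mem: "y \<in> carrier G" if "y \<in> A" for y using A that by blast
    show "bij_betw (\<lambda>y. t (x \<otimes>\<^bsub>G\<^esub> y)) A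
        {h \<in> carrier G. a \<otimes>\<^bsub>G\<^esub> (s x \<otimes>\<^bsub>G\<^esub> (b \<otimes>\<^bsub>G\<^esub> (h \<otimes>\<^bsub>G\<^esub> c))) \<in> A}"
    proof (rule bij_betw_byWitness[where f' = "\<lambda>h. inv\<^bsub>G\<^esub> x \<otimes>\<^bsub>G\<^esub> (h \<otimes>\<^bsub>G\<^esub> c)"])
      have canc: "inv\<^bsub>G\<^esub> x \<otimes>\<^bsub>G\<^esub> (t (x \<otimes>\<^bsub>G\<^esub> y) \<otimes>\<^bsub>G\<^esub> c) = y" if "y \<in> carrier G" for y
      proof -
        have "inv\<^bsub>G\<^esub> x \<otimes>\<^bsub>G\<^esub> (t (x \<otimes>\<^bsub>G\<^esub> y) \<otimes>\<^bsub>G\<^esub> c)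
            = (inv\<^bsub>G\<^esub> x \<otimes>\<^bsub>G\<^esub> x) \<otimes>\<^bsub>G\<^esub> (y \<otimes>\<^bsub>G\<^esub> (inv\<^bsub>G\<^esub> c \<otimes>\<^bsub>G\<^esub> c))"
          using abc x that by (simp only: t_def m_assoc inv_closed m_closed)
        then show ?thesis using abc x that by simp
      qed
      have tc: "t (x \<otimes>\<^bsub>G\<^esub> y) \<in> carrier G" if "y \<in> carrier G" for y
        using abc x that by (simp add: t_def)
      show "\<forall>y\<in>A. inv\<^bsub>G\<^esub> x \<otimes>\<^bsub>G\<^esub> (t (x \<otimes>\<^bsub>G\<^esub> y) \<otimes>\<^bsub>G\<^esub> c) = y" using canc mem by blast
      show "(\<lambda>y. t (x \<otimes>\<^bsub>G\<^esub> y)) ` A \<subseteq> {h \<in> carrier G. a \<otimes>\<^bsub>G\<^esub> (s x \<otimes>\<^bsub>G\<^esub> (b \<otimes>\<^bsub>G\<^esub> (h \<otimes>\<^bsub>G\<^esub> c))) \<in> A}"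
        using canc mem tc eq by auto
      show "\<forall>h\<in>{h \<in> carrier G. a \<otimes>\<^bsub>G\<^esub> (s x \<otimes>\<^bsub>G\<^esub> (b \<otimes>\<^bsub>G\<^esub> (h \<otimes>\<^bsub>G\<^esub> c))) \<in> A}.
          t (x \<otimes>\<^bsub>G\<^esub> (inv\<^bsub>G\<^esub> x \<otimes>\<^bsub>G\<^esub> (h \<otimes>\<^bsub>G\<^esub> c))) = h"
      proof
        fix h assume "h \<in> {h \<in> carrier G. a \<otimes>\<^bsub>G\<^esub> (s x \<otimes>\<^bsub>G\<^esub> (b \<otimes>\<^bsub>G\<^esub> (h \<otimes>\<^bsub>G\<^esub> c))) \<in> A}"
        then have h: "h \<in> carrier G" by simp
        have "t (x \<otimes>\<^bsub>G\<^esub> (inv\<^bsub>G\<^esub> x \<otimes>\<^bsub>G\<^esub> (h \<otimes>\<^bsub>G\<^esub> c))) = (x \<otimes>\<^bsub>G\<^esub> inv\<^bsub>G\<^esub> x) \<otimes>\<^bsub>G\<^esub> (h \<otimes>\<^bsub>G\<^esub> (c \<otimes>\<^bsub>G\<^esub> inv\<^bsub>G\<^esub> c))"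
          using abc x h by (simp only: t_def m_assoc inv_closed m_closed)
        then show "t (x \<otimes>\<^bsub>G\<^esub> (inv\<^bsub>G\<^esub> x \<otimes>\<^bsub>G\<^esub> (h \<otimes>\<^bsub>G\<^esub> c))) = h" using abc x h by simp
      qed
      show "(\<lambda>h. inv\<^bsub>G\<^esub> x \<otimes>\<^bsub>G\<^esub> (h \<otimes>\<^bsub>G\<^esub> c)) ` {h \<in> carrier G. a \<otimes>\<^bsub>G\<^esub> (s x \<otimes>\<^bsub>G\<^esub> (b \<otimes>\<^bsub>G\<^esub> (h \<otimes>\<^bsub>G\<^esub> c))) \<in> A} \<subseteq> A"
        using eq by auto
    qed
  qed
  have "(\<Sum>g\<in>carrier G. v g * (\<Sum>h | h \<in> carrier G \<and> a \<otimes>\<^bsub>G\<^esub> (g \<otimes>\<^bsub>G\<^esub> (b \<otimes>\<^bsub>G\<^esub> (h \<otimes>\<^bsub>G\<^esub> c))) \<in> A. u h))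
      = (\<Sum>x\<in>carrier G. v (s x) * (\<Sum>h | h \<in> carrier G \<and> a \<otimes>\<^bsub>G\<^esub> (s x \<otimes>\<^bsub>G\<^esub> (b \<otimes>\<^bsub>G\<^esub> (h \<otimes>\<^bsub>G\<^esub> c))) \<in> A. u h))"
    by (rule sum.reindex_bij_betw[OF s, symmetric])
  also have "\<dots> = (\<Sum>x\<in>carrier G. v (s x) * (\<Sum>y\<in>A. u (t (x \<otimes>\<^bsub>G\<^esub> y))))"
    by (intro sum.cong refl) (simp add: inner)
  also have "\<bar>\<dots>\<bar> \<le> nu G A * L2_set (\<lambda>x. v (s x)) (carrier G) * L2_set (\<lambda>x. u (t x)) (carrier G)"
    using u sum.reindex_bij_betw[OF t, of u]
    by (intro translate_sum_bound assms) simp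
  finally show ?thesis by (simp only: L2[OF s] L2[OF t])
qed

text \<open>The relation between the two free levels is biregular of degree |A|; the other half is
  \<open>card_translate_left\<close>. This yields the term |A| of the estimate and removes a cross
  term between constant and zero-sum parts.\<close>

lemma card_translate_right:
  assumes "group G" and A: "A \<subseteq> carrier G"
    and abc: "a \<in> carrier G" "b \<in> carrier G" "c \<in> carrier G" and g: "g \<in> carrier G"
  shows "card {h \<in> carrier G. a \<otimes>\<^bsub>G\<^esub> (g \<otimes>\<^bsub>G\<^esub> (b \<otimes>\<^bsub>G\<^esub> (h \<otimes>\<^bsub>G\<^esub> c))) \<in> A} = card A" (is "card ?R = _")
proof -
  interpret group G by fact
  let ?w = "a \<otimes>\<^bsub>G\<^esub> (g \<otimes>\<^bsub>G\<^esub> b)"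
  have "bij_betw (\<lambda>h. ?w \<otimes>\<^bsub>G\<^esub> h \<otimes>\<^bsub>G\<^esub> c) ?R A"
  proof (rule bij_betw_byWitness[where f' = "\<lambda>y. inv\<^bsub>G\<^esub> ?w \<otimes>\<^bsub>G\<^esub> (y \<otimes>\<^bsub>G\<^esub> inv\<^bsub>G\<^esub> c)"])
  qed (use abc g A in \<open>auto simp: m_assoc inv_mult_group subset_iff, simp_all flip: m_assoc\<close>)
  then show ?thesis by (rule bij_betw_same_card)
qed

lemma card_translate_left:
  assumes "group G" and A: "A \<subseteq> carrier G"
    and abc: "a \<in> carrier G" "b \<in> carrier G" "c \<in> carrier G" and h: "h \<in> carrier G"
  shows "card {g \<in> carrier G. a \<otimes>\<^bsub>G\<^esub> (g \<otimes>\<^bsub>G\<^esub> (b \<otimes>\<^bsub>G\<^esub> (h \<otimes>\<^bsub>G\<^esub> c))) \<in> A} = card A" (is "card ?L = _")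
proof -
  interpret group G by fact
  let ?w = "b \<otimes>\<^bsub>G\<^esub> (h \<otimes>\<^bsub>G\<^esub> c)"
  have "bij_betw (\<lambda>g. a \<otimes>\<^bsub>G\<^esub> (g \<otimes>\<^bsub>G\<^esub> ?w)) ?L A"
  proof (rule bij_betw_byWitness[where f' = "\<lambda>y. inv\<^bsub>G\<^esub> a \<otimes>\<^bsub>G\<^esub> (y \<otimes>\<^bsub>G\<^esub> inv\<^bsub>G\<^esub> ?w)"])
  qed (use abc h A in \<open>auto simp: m_assoc inv_mult_group subset_iff, simp_all flip: m_assoc\<close>)
  then show ?thesis by (rule bij_betw_same_card)
qed

lemma join_pair_inequality:
  fixes u v :: "'a \<Rightarrow> real"
  assumes "group G" and fin: "finite (carrier G)" and A: "A \<subseteq> carrier G"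
    and abc: "a \<in> carrier G" "b \<in> carrier G" "c \<in> carrier G"
  defines "E \<equiv> {(g, h). g \<in> carrier G \<and> h \<in> carrier G \<and>
      a \<otimes>\<^bsub>G\<^esub> (g \<otimes>\<^bsub>G\<^esub> (b \<otimes>\<^bsub>G\<^esub> (h \<otimes>\<^bsub>G\<^esub> c))) \<in> A}"
  shows "((\<Sum>g\<in>carrier G. v g) + (\<Sum>h\<in>carrier G. u h))\<^sup>2 - 2 * (\<Sum>(g, h)\<in>E. v g * u h)
    \<ge> - nu G A * ((\<Sum>g\<in>carrier G. (v g)\<^sup>2) + (\<Sum>h\<in>carrier G. (u h)\<^sup>2))"
proof -
  interpret group G by fact
  let ?C = "carrier G"
  have finA: "finite A" using A fin finite_subset by blast
  define n where "n = real (card ?C)"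
  have n: "n > 0" using fin by (auto simp: n_def card_gt_0_iff)
  define s t where "s = (\<Sum>g\<in>?C. v g)" and "t = (\<Sum>h\<in>?C. u h)"
  define v0 u0 where "v0 g = v g - s / n" and "u0 h = u h - t / n" for g h
  have z: "(\<Sum>g\<in>?C. v0 g) = 0" "(\<Sum>g\<in>?C. u0 g) = 0"
    using n by (simp_all add: v0_def u0_def sum_subtractf s_def t_def n_def)
  let ?R = "\<lambda>g. {h \<in> ?C. a \<otimes>\<^bsub>G\<^esub> (g \<otimes>\<^bsub>G\<^esub> (b \<otimes>\<^bsub>G\<^esub> (h \<otimes>\<^bsub>G\<^esub> c))) \<in> A}"
  let ?L = "\<lambda>h. {g \<in> ?C. a \<otimes>\<^bsub>G\<^esub> (g \<otimes>\<^bsub>G\<^esub> (b \<otimes>\<^bsub>G\<^esub> (h \<otimes>\<^bsub>G\<^esub> c))) \<in> A}"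
  have cR: "card (?R g) = card A" if g: "g \<in> ?C" for g
    by (rule card_translate_right[OF assms(1) A abc g])
  have cL: "card (?L h) = card A" if h: "h \<in> ?C" for h
    by (rule card_translate_left[OF assms(1) A abc h])
  \<comment> \<open>Each h lies in \<open>?R g\<close> for exactly |A| elements g, so the pairing of
    a constant with \<open>u0\<close> is a multiple of the sum of \<open>u0\<close>.\<close>
  have swap: "(\<Sum>g\<in>?C. \<Sum>h\<in>?R g. u0 h) = 0"
  proof -
    have "(\<Sum>g\<in>?C. \<Sum>h\<in>?R g. u0 h) = (\<Sum>h\<in>?C. \<Sum>g\<in>?L h. u0 h)"
      by (rule sum.swap_restrict[OF fin fin])
    also have "\<dots> = real (card A) * (\<Sum>h\<in>?C. u0 h)"
      by (simp add: cL sum_distrib_left)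
    finally show ?thesis using z by simp
  qed
  define B where "B = (\<Sum>g\<in>?C. v0 g * (\<Sum>h\<in>?R g. u0 h))"
  define q where "q = real (card A) / n"
  have q: "0 \<le> q" "q \<le> 1"
    using card_mono[OF fin A] n by (simp_all add: q_def n_def)
  have "E = Sigma ?C ?R" by (auto simp: E_def)
  then have "(\<Sum>(g, h)\<in>E. v g * u h) = (\<Sum>g\<in>?C. \<Sum>h\<in>?R g. v g * u h)"
    using fin by (simp add: sum.Sigma)
  also have "\<dots> = (\<Sum>g\<in>?C. v g * (\<Sum>h\<in>?R g. u h))"
    by (simp add: sum_distrib_left)
  \<comment> \<open>In the last summand \<open>v g\<close> is left whole, so that its sum s appears
    and the total is q s t. The middle summand vanishes by \<open>swap\<close>.\<close>
  also have "\<dots> = (\<Sum>g\<in>?C. v0 g * (\<Sum>h\<in>?R g. u0 h) + s / n * (\<Sum>h\<in>?R g. u0 h) + v g * (q * t))"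
  proof (intro sum.cong refl)
    fix g assume g: "g \<in> ?C"
    have "(\<Sum>h\<in>?R g. u h) = (\<Sum>h\<in>?R g. u0 h) + q * t"
      using cR[OF g] by (simp add: u0_def sum_subtractf q_def)
    moreover have "v g = v0 g + s / n" by (simp add: v0_def)
    ultimately show "v g * (\<Sum>h\<in>?R g. u h)
        = v0 g * (\<Sum>h\<in>?R g. u0 h) + s / n * (\<Sum>h\<in>?R g. u0 h) + v g * (q * t)"
      by (simp add: algebra_simps)
  qed
  also have "\<dots> = B + q * s * t"
    by (simp only: sum.distrib flip: sum_distrib_left sum_distrib_right)
      (simp add: swap B_def flip: s_def)
  finally have E: "(\<Sum>(g, h)\<in>E. v g * u h) = B + q * s * t" .
  have sq: "(L2_set w ?C)\<^sup>2 = (\<Sum>g\<in>?C. (w g)\<^sup>2)" for w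
    by (simp add: L2_set_def sum_nonneg)
  \<comment> \<open>Subtracting the mean lowers the sum of squares by \<open>r\<^sup>2 / n\<close>,
    so returning from \<open>v0\<close> and \<open>u0\<close> to v and u only weakens the
    bound.\<close>
  have le: "(\<Sum>g\<in>?C. (w g - r / n)\<^sup>2) \<le> (\<Sum>g\<in>?C. (w g)\<^sup>2)" if "r = (\<Sum>g\<in>?C. w g)" for w r
  proof -
    have "(\<Sum>g\<in>?C. (w g - r / n)\<^sup>2) = (\<Sum>g\<in>?C. (w g)\<^sup>2 - 2 * r / n * w g + (r / n)\<^sup>2)"
      by (intro sum.cong) (auto simp: power2_eq_square algebra_simps)
    also have "\<dots> = (\<Sum>g\<in>?C. (w g)\<^sup>2) - 2 * r / n * (\<Sum>g\<in>?C. w g) + n * (r / n)\<^sup>2"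
      by (simp add: sum.distrib sum_subtractf sum_distrib_left n_def)
    also have "\<dots> = (\<Sum>g\<in>?C. (w g)\<^sup>2) - r\<^sup>2 / n"
      using n by (simp add: power2_eq_square flip: that)
    finally show ?thesis using n by simp
  qed
  have "B \<le> nu G A * L2_set v0 ?C * L2_set u0 ?C"
    unfolding B_def using incidence_form_bound[OF assms(1) fin A abc z(2), of v0] by linarith
  also have "\<dots> = nu G A * (L2_set v0 ?C * L2_set u0 ?C)" by simp
  also have "\<dots> \<le> nu G A * (((L2_set v0 ?C)\<^sup>2 + (L2_set u0 ?C)\<^sup>2) / 2)"
    using sum_squares_bound[of "L2_set v0 ?C" "L2_set u0 ?C"]
    by (intro mult_left_mono nu_nonneg finA A) simp
  also have "\<dots> \<le> nu G A * (((\<Sum>g\<in>?C. (v g)\<^sup>2) + (\<Sum>h\<in>?C. (u h)\<^sup>2)) / 2)"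
    using le[OF s_def] le[OF t_def] unfolding sq v0_def u0_def
    by (intro mult_left_mono nu_nonneg finA A) simp
  finally have B: "2 * B \<le> nu G A * ((\<Sum>g\<in>?C. (v g)\<^sup>2) + (\<Sum>h\<in>?C. (u h)\<^sup>2))" by simp
  \<comment> \<open>The left side is affine in q, with value \<open>(s + t)\<^sup>2\<close> at q = 0
    and \<open>s\<^sup>2 + t\<^sup>2\<close> at q = 1; the density q lies between.\<close>
  have "(s + t)\<^sup>2 - 2 * (q * s * t) = q * (s\<^sup>2 + t\<^sup>2) + (1 - q) * (s + t)\<^sup>2"
    by (simp add: power2_eq_square algebra_simps)
  also have "\<dots> \<ge> 0" using q by simp
  finally show ?thesis using B unfolding E s_def[symmetric] t_def[symmetric] by simp
qed

section \<open>Cochains as functions on ordered simplices\<close>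

definition omit :: "nat \<Rightarrow> 'v list \<Rightarrow> 'v list" where
  "omit i xs = take i xs @ drop (Suc i) xs"

text \<open>On cochains this is the adjoint of the coboundary. No membership test on v # xs is needed,
  since cochains vanish off the ordered simplices.\<close>

definition cadj :: "'v set set \<Rightarrow> ('v list \<Rightarrow> real) \<Rightarrow> 'v list \<Rightarrow> real" where
  "cadj X \<psi> xs = (\<Sum>v\<in>\<Union>X. \<psi> (v # xs))"

text \<open>Summing over all ordered simplices, i.e. m! times cinner, avoids the choice of orientations
  and makes every simplex of the join symmetric in its levels.\<close>

definition oinner :: "'v set set \<Rightarrow> nat \<Rightarrow> ('v list \<Rightarrow> real) \<Rightarrow> ('v list \<Rightarrow> real) \<Rightarrow> real" where
  "oinner X m \<phi> \<psi> = (\<Sum>xs\<in>osimp X m. \<phi> xs * \<psi> xs)"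

section \<open>Permuting an ordered simplex and deleting a vertex\<close>

lemma length_omit: "i < length xs \<Longrightarrow> length (omit i xs) = length xs - 1"
  by (auto simp: omit_def)

lemma nth_omit:
  "i < length xs \<Longrightarrow> j < length xs - 1 \<Longrightarrow> omit i xs ! j = xs ! insert_index i j"
  by (auto simp: omit_def nth_append insert_index_def)

lemma mset_omit: "i < length xs \<Longrightarrow> add_mset (xs ! i) (mset (omit i xs)) = mset xs"
  unfolding omit_def by (metis id_take_nth_drop mset.simps(2) mset_append union_mset_add_mset_right)

lemma permute_list_eqI:
  assumes "length ys = length xs" "p permutes {..<length xs}"
    "\<And>i. i < length xs \<Longrightarrow> ys ! i = xs ! p i"
  shows "permute_list p xs = ys"
  using assms by (intro nth_equalityI) (auto simp: permute_list_nth)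

lemma permutation_insert_insert_index:
  "permutation_insert i j p (insert_index i k) = insert_index j (p k)"
  by (auto simp: permutation_insert_expand insert_index_def)

text \<open>Position i of the permuted list holds entry \<open>p i\<close> of the original, and the
  remaining entries are rearranged by the minor of p. The map \<open>insert_index i\<close> skips i
  and translates positions of the shortened list into positions of the full one.\<close>

lemma omit_permute_list:
  assumes p: "p permutes {..<Suc m}" and xs: "length xs = Suc m" and i: "i < Suc m"
  shows "omit i (permute_list p xs) = permute_list (permutation_delete p i) (omit (p i) xs)"
proof -
  let ?q = "permutation_delete p i"
  have pi: "p i < Suc m" using permutes_in_image[OF p, of i] i by simp
  have p': "p permutes {0..<Suc m}" using p by (simp add: atLeast0LessThan)
  have q: "?q permutes {..<m}"
    using permutation_delete_permutes[OF p' i] by (simp add: atLeast0LessThan)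
  show ?thesis
  proof (rule permute_list_eqI[symmetric])
    show "?q permutes {..<length (omit (p i) xs)}" using q pi xs by (simp add: length_omit)
    fix k assume "k < length (omit (p i) xs)"
    then have k: "k < m" using pi xs by (simp add: length_omit)
    have qk: "?q k < m" using permutes_in_image[OF q, of k] k by simp
    have "insert_index i k < Suc m" using k by (auto simp: insert_index_def)
    moreover have "insert_index (p i) (?q k) = p (insert_index i k)"
      using permutation_insert_insert_index[of i "p i" ?q k] permutation_insert_delete[OF p' i] by simp
    ultimately show "omit i (permute_list p xs) ! k = omit (p i) xs ! ?q k"
      using k qk xs i pi p by (simp add: nth_omit permute_list_nth)
  qed (use xs i pi in \<open>simp add: length_omit\<close>)
qed

text \<open>The sign rule of the Laplace expansion of a determinant, for the entry in row i and
  column \<open>p i\<close>.\<close>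

lemma sign_permutation_delete:
  assumes p: "p permutes {..<Suc m}" and i: "i < Suc m"
  shows "real_of_int (sign p) = (- 1) ^ (i + p i) * real_of_int (sign (permutation_delete p i))"
proof -
  have p': "p permutes {0..<Suc m}" using p by (simp add: atLeast0LessThan)
  have "p i < Suc m" using permutes_in_image[OF p, of i] i by simp
  then show ?thesis
    using signof_permutation_insert[OF permutation_delete_permutes[OF p' i] i, of "p i", where 'a = real]
    by (simp add: permutation_insert_delete[OF p' i])
qed

lemma sign_square: "real_of_int (sign p) * real_of_int (sign p) = 1"
  by (simp add: sign_def)

lemma cochains_permute:
  "\<phi> \<in> cochains X m \<Longrightarrow> xs \<in> osimp X m \<Longrightarrow> p permutes {..<m} \<Longrightarrow>
    \<phi> (permute_list p xs) = real_of_int (sign p) * \<phi> xs"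
  by (auto simp: cochains_def)

lemma cochains_eq_0: "\<phi> \<in> cochains X m \<Longrightarrow> xs \<notin> osimp X m \<Longrightarrow> \<phi> xs = 0"
  by (auto simp: cochains_def)

lemma cochains_lincomb:
  assumes "finite I" "\<And>i. i \<in> I \<Longrightarrow> e i \<in> cochains X m"
  shows "(\<lambda>xs. \<Sum>i\<in>I. c i * e i xs) \<in> cochains X m"
  using assms by (auto simp: cochains_def sum_distrib_left mult.left_commute intro!: sum.cong)

lemma permute_list_osimp:
  assumes "xs \<in> osimp X m" "p permutes {..<m}"
  shows "permute_list p xs \<in> osimp X m"
  using assms by (auto simp: osimp_def)

text \<open>The permutation sends 0 to i and keeps the order of the rest; its sign is that of i
  transpositions. This identity absorbs the alternating signs of the coboundary.\<close>

lemma cochains_move_front: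
  assumes \<phi>: "\<phi> \<in> cochains X m" and xs: "xs \<in> osimp X m" and i: "i < m"
  shows "\<phi> (xs ! i # omit i xs) = (- 1) ^ i * \<phi> xs"
proof -
  obtain n where m: "m = Suc n" using i by (cases m) auto
  have len: "length xs = Suc n" using xs m by (simp add: osimp_def)
  have id: "id permutes {0..<n}" by (simp add: permutes_id)
  let ?p = "permutation_insert 0 i id"
  have p: "?p permutes {..<Suc n}"
    using permutation_insert_permutes[OF id, of 0 i] i m by (simp add: atLeast0LessThan)
  have "permute_list ?p xs = xs ! i # omit i xs"
  proof (rule permute_list_eqI)
    show "(xs ! i # omit i xs) ! j = xs ! ?p j" if "j < length xs" for j
    proof (cases j)
      case (Suc k)
      then show ?thesis
        using that len i m permutation_insert_insert_index[of 0 i id k]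
        by (simp add: nth_omit insert_index_def)
    qed simp
  qed (use len i m p in \<open>simp_all add: length_omit\<close>)
  moreover have "real_of_int (sign ?p) = (- 1) ^ i"
    using signof_permutation_insert[OF id, of 0 i, where 'a = real] i m by simp
  ultimately show ?thesis
    using cochains_permute[OF \<phi> xs, of ?p] p m by simp
qed

lemma orient:
  assumes "finite \<sigma>"
  shows "distinct (orient \<sigma>)" "set (orient \<sigma>) = \<sigma>"
  using someI_ex[OF finite_distinct_list[OF assms, unfolded conj_commute[of "set _ = _"]]]
  by (auto simp: orient_def)

lemma distinct_set_permute_list:
  assumes "distinct xs" "distinct ys" "set xs = set ys"
  obtains p where "p permutes {..<length ys}" "xs = permute_list p ys"
proof -
  have "mset xs = mset ys" using assms by (simp add: set_eq_iff_mset_eq_distinct)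
  then show thesis by (rule mset_eq_permutation) (use that in auto)
qed

lemma permute_list_inj:
  assumes q: "q permutes {..<length xs}" and "length xs = length ys"
    and "permute_list q xs = permute_list q ys"
  shows "xs = ys"
proof -
  have "permute_list (inv_into UNIV q) (permute_list q xs) = permute_list (inv_into UNIV q) (permute_list q ys)"
    using assms(3) by simp
  then show ?thesis
    using permute_list_compose[of "inv_into UNIV q" xs q] permute_list_compose[of "inv_into UNIV q" ys q]
      permutes_inv[OF q] permutes_inv_o(1)[OF q] assms(2) by simp
qed

section \<open>Coboundary, inner product and adjoint on a finite complex\<close>

locale simplicial_complex =
  fixes X :: "'v set set"
  assumes finite_vertices: "finite (\<Union>X)"
    and face_closed: "\<And>\<sigma> \<tau>. \<sigma> \<in> X \<Longrightarrow> \<tau> \<subseteq> \<sigma> \<Longrightarrow> \<tau> \<in> X"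
begin

definition faces :: "nat \<Rightarrow> 'v set set" where
  "faces m = {\<sigma>\<in>X. finite \<sigma> \<and> card \<sigma> = m}"

lemma finite_faces: "finite (faces m)"
  by (rule finite_subset[of _ "Pow (\<Union>X)"]) (auto simp: faces_def finite_vertices)

lemma finite_osimp: "finite (osimp X m)"
  by (rule finite_subset[OF _ finite_lists_length_eq[OF finite_vertices, of m]])
    (auto simp: osimp_def)

lemma orient_osimp: "\<sigma> \<in> faces m \<Longrightarrow> orient \<sigma> \<in> osimp X m"
  using orient[of \<sigma>] distinct_card[of "orient \<sigma>"] by (auto simp: faces_def osimp_def)

lemma set_osimp_faces: "xs \<in> osimp X m \<Longrightarrow> set xs \<in> faces m"
  by (auto simp: osimp_def faces_def distinct_card)

lemma osimp_orient:
  assumes "xs \<in> osimp X m"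
  obtains p where "p permutes {..<m}" "xs = permute_list p (orient (set xs))"
proof -
  have "length (orient (set xs)) = m"
    using orient_osimp[OF set_osimp_faces[OF assms]] by (simp add: osimp_def)
  moreover obtain p where "p permutes {..<length (orient (set xs))}"
    "xs = permute_list p (orient (set xs))"
    by (rule distinct_set_permute_list[of xs "orient (set xs)"])
      (use orient[of "set xs"] assms in \<open>auto simp: osimp_def\<close>)
  ultimately show thesis using that by simp
qed

lemma omit_osimp: "xs \<in> osimp X (Suc m) \<Longrightarrow> i < Suc m \<Longrightarrow> omit i xs \<in> osimp X m"
proof -
  assume xs: "xs \<in> osimp X (Suc m)" and i: "i < Suc m"
  have "set (omit i xs) \<subseteq> set xs"
    by (auto simp: omit_def dest: in_set_takeD in_set_dropD)
  moreover have "distinct (omit i xs)"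
    using xs by (auto simp: omit_def osimp_def set_take_disj_set_drop_if_distinct)
  ultimately show ?thesis
    using xs i face_closed by (auto simp: osimp_def length_omit)
qed

lemma osimp_Cons: "v # xs \<in> osimp X (Suc m) \<Longrightarrow> xs \<in> osimp X m \<and> v \<in> \<Union>X"
  using face_closed[of "insert v (set xs)" "set xs"] by (auto simp: osimp_def)

lemma cochain_eqI:
  assumes "\<phi> \<in> cochains X m" "\<psi> \<in> cochains X m"
    and "\<And>\<sigma>. \<sigma> \<in> faces m \<Longrightarrow> \<phi> (orient \<sigma>) = \<psi> (orient \<sigma>)"
  shows "\<phi> = \<psi>"
proof
  fix xs
  show "\<phi> xs = \<psi> xs"
  proof (cases "xs \<in> osimp X m")
    case True
    obtain p where p: "p permutes {..<m}" "xs = permute_list p (orient (set xs))"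
      using osimp_orient[OF True] .
    have "orient (set xs) \<in> osimp X m" by (intro orient_osimp set_osimp_faces True)
    then show ?thesis
      using cochains_permute[OF assms(1) _ p(1)] cochains_permute[OF assms(2) _ p(1)]
        assms(3)[OF set_osimp_faces[OF True]] p(2) by metis
  qed (simp add: cochains_eq_0[OF assms(1)] cochains_eq_0[OF assms(2)])
qed

lemma cobd_osimp:
  "xs \<in> osimp X (Suc m) \<Longrightarrow> cobd X m \<phi> xs = (\<Sum>i<Suc m. (- 1) ^ i * \<phi> (omit i xs))"
  by (simp add: cobd_def omit_def)

text \<open>The facets of a permuted simplex are the permuted facets. The sign of the minor replaces
  (-1)^i by (-1)^(p i) at the cost of the sign of p, after which p reindexes the sum.\<close>

lemma cobd_cochain:
  assumes \<phi>: "\<phi> \<in> cochains X m"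
  shows "cobd X m \<phi> \<in> cochains X (Suc m)"
  unfolding cochains_def
proof (intro CollectI conjI allI impI ballI)
  show "cobd X m \<phi> xs = 0" if "xs \<notin> osimp X (Suc m)" for xs using that by (simp add: cobd_def)
  fix xs p assume xs: "xs \<in> osimp X (Suc m)" and p: "p permutes {..<Suc m}"
  have len: "length xs = Suc m" using xs by (simp add: osimp_def)
  have "cobd X m \<phi> (permute_list p xs) = (\<Sum>i<Suc m. (- 1) ^ i * \<phi> (omit i (permute_list p xs)))"
    by (intro cobd_osimp permute_list_osimp xs p)
  also have "\<dots> = (\<Sum>i<Suc m. real_of_int (sign p) * ((- 1) ^ p i * \<phi> (omit (p i) xs)))"
  proof (intro sum.cong refl)
    fix i assume "i \<in> {..<Suc m}"
    then have i: "i < Suc m" by simp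
    have pi: "p i < Suc m" using permutes_in_image[OF p, of i] i by simp
    have p': "p permutes {0..<Suc m}" using p by (simp add: atLeast0LessThan)
    have q: "permutation_delete p i permutes {..<m}"
      using permutation_delete_permutes[OF p' i] by (simp add: atLeast0LessThan)
    have one: "(- 1) ^ (i + p i) * (- 1) ^ p i = ((- 1) ^ i :: real)"
      by (simp add: power_add mult.assoc flip: power_mult_distrib)
    have "\<phi> (omit i (permute_list p xs))
        = real_of_int (sign (permutation_delete p i)) * \<phi> (omit (p i) xs)"
      unfolding omit_permute_list[OF p len i]
      by (intro cochains_permute[OF \<phi>] omit_osimp xs pi q)
    then show "(- 1) ^ i * \<phi> (omit i (permute_list p xs))
        = real_of_int (sign p) * ((- 1) ^ p i * \<phi> (omit (p i) xs))"
      unfolding sign_permutation_delete[OF p i] by (simp add: mult_ac flip: one)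
  qed
  also have "\<dots> = real_of_int (sign p) * (\<Sum>i<Suc m. (- 1) ^ p i * \<phi> (omit (p i) xs))"
    by (rule sum_distrib_left[symmetric])
  also have "(\<Sum>i<Suc m. (- 1) ^ p i * \<phi> (omit (p i) xs)) = cobd X m \<phi> xs"
    unfolding cobd_osimp[OF xs]
    by (rule sum.reindex_bij_betw[OF permutes_imp_bij[OF p], of "\<lambda>i. (- 1) ^ i * \<phi> (omit i xs)"])
  finally show "cobd X m \<phi> (permute_list p xs) = real_of_int (sign p) * cobd X m \<phi> xs" .
qed

lemma cadj_cochain:
  assumes \<psi>: "\<psi> \<in> cochains X (Suc m)"
  shows "cadj X \<psi> \<in> cochains X m"
  unfolding cochains_def
proof (intro CollectI conjI allI impI ballI)
  show "cadj X \<psi> xs = 0" if "xs \<notin> osimp X m" for xs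
    unfolding cadj_def using that osimp_Cons[of _ xs m] by (intro sum.neutral ballI cochains_eq_0[OF \<psi>]) blast
  fix xs p assume xs: "xs \<in> osimp X m" and p: "p permutes {..<m}"
  have len: "length xs = m" using xs by (simp add: osimp_def)
  \<comment> \<open>p shifted by one position, with the new front vertex fixed; the sign stays the
    same.\<close>
  let ?q = "permutation_insert 0 0 p"
  have p': "p permutes {0..<m}" using p by (simp add: atLeast0LessThan)
  have q: "?q permutes {..<Suc m}"
    using permutation_insert_permutes[OF p', of 0 0] by (simp add: atLeast0LessThan)
  have sq: "real_of_int (sign ?q) = real_of_int (sign p)"
    using signof_permutation_insert[OF p', of 0 0, where 'a = real] by simp
  have qv: "permute_list ?q (v # xs) = v # permute_list p xs" for v
  proof (rule permute_list_eqI)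
    show "(v # permute_list p xs) ! j = (v # xs) ! ?q j" if "j < length (v # xs)" for j
    proof (cases j)
      case (Suc k)
      then show ?thesis
        using that len p permutation_insert_insert_index[of 0 0 p k]
        by (simp add: permute_list_nth insert_index_def)
    qed simp
  qed (use len q in simp_all)
  have "\<psi> (v # permute_list p xs) = real_of_int (sign p) * \<psi> (v # xs)" for v
  proof (cases "v # xs \<in> osimp X (Suc m)")
    case True
    then show ?thesis using cochains_permute[OF \<psi> True q] by (simp add: qv sq)
  next
    case False
    have "v # permute_list p xs \<notin> osimp X (Suc m)"
      using False p len by (auto simp: osimp_def)
    then show ?thesis using False by (simp add: cochains_eq_0[OF \<psi>])
  qed
  then show "cadj X \<psi> (permute_list p xs) = real_of_int (sign p) * cadj X \<psi> xs"
    by (simp add: cadj_def sum_distrib_left)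
qed

text \<open>Moving a vertex to the front permutes the ordered simplices, since the vertex set stays
  the same. Consequently all positions in a coboundary sum contribute equally.\<close>

lemma sum_osimp_move_front:
  assumes i: "i < Suc m"
  shows "(\<Sum>xs\<in>osimp X (Suc m). H (xs ! i # omit i xs)) = (\<Sum>xs\<in>osimp X (Suc m). H xs)"
proof (rule sum.reindex_bij_witness[where i = "\<lambda>xs. take i (tl xs) @ hd xs # drop i (tl xs)"
      and j = "\<lambda>xs. xs ! i # omit i xs"])
  fix xs assume xs: "xs \<in> osimp X (Suc m)"
  then have len: "length xs = Suc m" by (simp add: osimp_def)
  show "take i (tl (xs ! i # omit i xs)) @ hd (xs ! i # omit i xs) # drop i (tl (xs ! i # omit i xs)) = xs"
    using len i by (simp add: omit_def id_take_nth_drop[symmetric] min_def)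
  have ms: "mset (xs ! i # omit i xs) = mset xs" using mset_omit[of i xs] len i by simp
  show "xs ! i # omit i xs \<in> osimp X (Suc m)"
    using xs mset_eq_imp_distinct_iff[OF ms] mset_eq_setD[OF ms] mset_eq_length[OF ms]
    by (simp add: osimp_def)
  obtain v ys where vs: "xs = v # ys" "length ys = m" using len by (cases xs) auto
  let ?zs = "take i (tl xs) @ hd xs # drop i (tl xs)"
  show "?zs ! i # omit i ?zs = xs"
    using vs i by (simp add: omit_def nth_append)
  have "mset ?zs = mset (v # take i ys @ drop i ys)"
    using vs by (simp del: append_take_drop_id)
  then have ms: "mset ?zs = mset xs" using vs by simp
  show "?zs \<in> osimp X (Suc m)"
    using xs mset_eq_imp_distinct_iff[OF ms] mset_eq_setD[OF ms] mset_eq_length[OF ms]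
    by (simp add: osimp_def)
qed simp

text \<open>A vertex that does not extend \<open>ys\<close> contributes 0, so v may run over all
  vertices independently of \<open>ys\<close>.\<close>

lemma sum_osimp_Suc:
  assumes "\<And>xs. xs \<notin> osimp X (Suc m) \<Longrightarrow> H xs = 0"
  shows "(\<Sum>xs\<in>osimp X (Suc m). H xs) = (\<Sum>ys\<in>osimp X m. \<Sum>v\<in>\<Union>X. H (v # ys))"
proof -
  have "(\<Sum>ys\<in>osimp X m. \<Sum>v\<in>\<Union>X. H (v # ys))
      = (\<Sum>(ys, v)\<in>osimp X m \<times> \<Union>X. H (v # ys))"
    by (simp add: sum.cartesian_product)
  also have "\<dots> = (\<Sum>xs\<in>(\<lambda>(ys, v). v # ys) ` (osimp X m \<times> \<Union>X). H xs)"
    by (subst sum.reindex) (auto simp: inj_on_def intro!: sum.cong)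
  also have "\<dots> = (\<Sum>xs\<in>osimp X (Suc m). H xs)"
  proof (rule sum.mono_neutral_right)
    show "finite ((\<lambda>(ys, v). v # ys) ` (osimp X m \<times> \<Union>X))"
      using finite_osimp finite_vertices by blast
    show "osimp X (Suc m) \<subseteq> (\<lambda>(ys, v). v # ys) ` (osimp X m \<times> \<Union>X)"
    proof
      fix xs assume xs: "xs \<in> osimp X (Suc m)"
      then obtain v ys where vs: "xs = v # ys" by (cases xs) (auto simp: osimp_def)
      then show "xs \<in> (\<lambda>(ys, v). v # ys) ` (osimp X m \<times> \<Union>X)"
        using osimp_Cons[of v ys m] xs by force
    qed
  qed (use assms in auto)
  finally show ?thesis by simp
qed

text \<open>Each of the m + 1 positions gives the same total once its vertex is moved to the front.
  The factor is the ratio of (m + 1)! to m! between the normalisations of the two sides.\<close>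

lemma oinner_cobd:
  assumes \<psi>: "\<psi> \<in> cochains X (Suc m)"
  shows "oinner X (Suc m) (cobd X m \<chi>) \<psi> = real (Suc m) * oinner X m \<chi> (cadj X \<psi>)"
proof -
  let ?H = "\<lambda>xs. \<chi> (tl xs) * \<psi> xs"
  have "oinner X (Suc m) (cobd X m \<chi>) \<psi>
      = (\<Sum>xs\<in>osimp X (Suc m). \<Sum>i<Suc m. ?H (xs ! i # omit i xs))"
    unfolding oinner_def
  proof (intro sum.cong refl)
    fix xs assume xs: "xs \<in> osimp X (Suc m)"
    show "cobd X m \<chi> xs * \<psi> xs = (\<Sum>i<Suc m. ?H (xs ! i # omit i xs))"
      unfolding cobd_osimp[OF xs] sum_distrib_right
      by (intro sum.cong refl) (simp add: cochains_move_front[OF \<psi> xs] mult_ac)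
  qed
  also have "\<dots> = (\<Sum>i<Suc m. \<Sum>xs\<in>osimp X (Suc m). ?H (xs ! i # omit i xs))"
    by (rule sum.swap)
  also have "\<dots> = (\<Sum>i<Suc m. \<Sum>xs\<in>osimp X (Suc m). ?H xs)"
    by (intro sum.cong refl sum_osimp_move_front) simp
  also have "(\<Sum>xs\<in>osimp X (Suc m). ?H xs) = (\<Sum>ys\<in>osimp X m. \<Sum>v\<in>\<Union>X. ?H (v # ys))"
    by (rule sum_osimp_Suc) (simp add: cochains_eq_0[OF \<psi>])
  also have "\<dots> = oinner X m \<chi> (cadj X \<psi>)"
    by (simp add: oinner_def cadj_def sum_distrib_left)
  finally show ?thesis by simp
qed

text \<open>A simplex has m! orderings, and on each of them the signs of the two cochains multiply
  to 1, whatever orientation was chosen.\<close>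

lemma cinner_eq_oinner:
  assumes \<phi>: "\<phi> \<in> cochains X m" and \<psi>: "\<psi> \<in> cochains X m"
  shows "oinner X m \<phi> \<psi> = fact m * cinner X m \<phi> \<psi>"
proof -
  have "oinner X m \<phi> \<psi> = (\<Sum>\<sigma>\<in>faces m. \<Sum>xs | xs \<in> osimp X m \<and> set xs = \<sigma>. \<phi> xs * \<psi> xs)"
    unfolding oinner_def
    by (rule sum.group[symmetric]) (auto simp: finite_osimp finite_faces set_osimp_faces)
  also have "\<dots> = (\<Sum>\<sigma>\<in>faces m. fact m * (\<phi> (orient \<sigma>) * \<psi> (orient \<sigma>)))"
  proof (intro sum.cong refl)
    fix \<sigma> assume \<sigma>: "\<sigma> \<in> faces m"
    have o: "orient \<sigma> \<in> osimp X m" by (rule orient_osimp[OF \<sigma>])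
    have "{xs. xs \<in> osimp X m \<and> set xs = \<sigma>} = permutations_of_set \<sigma>"
      using \<sigma> by (auto simp: osimp_def permutations_of_set_def faces_def distinct_card)
    then have card: "card {xs. xs \<in> osimp X m \<and> set xs = \<sigma>} = fact m"
      using \<sigma> by (simp add: faces_def)
    have "(\<Sum>xs | xs \<in> osimp X m \<and> set xs = \<sigma>. \<phi> xs * \<psi> xs)
        = (\<Sum>xs | xs \<in> osimp X m \<and> set xs = \<sigma>. \<phi> (orient \<sigma>) * \<psi> (orient \<sigma>))"
    proof (intro sum.cong refl)
      fix xs assume xs: "xs \<in> {xs. xs \<in> osimp X m \<and> set xs = \<sigma>}"
      then obtain p where p: "p permutes {..<m}" "xs = permute_list p (orient \<sigma>)"
        using osimp_orient[of xs m] by auto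
      show "\<phi> xs * \<psi> xs = \<phi> (orient \<sigma>) * \<psi> (orient \<sigma>)"
        unfolding p(2) cochains_permute[OF \<phi> o p(1)] cochains_permute[OF \<psi> o p(1)]
        using sign_square[of p] by (simp add: mult_ac)
    qed
    then show "(\<Sum>xs | xs \<in> osimp X m \<and> set xs = \<sigma>. \<phi> xs * \<psi> xs)
        = fact m * (\<phi> (orient \<sigma>) * \<psi> (orient \<sigma>))"
      by (simp add: card)
  qed
  finally show ?thesis
    by (simp add: cinner_def faces_def sum_distrib_left)
qed

section \<open>An orthonormal basis of the cochains\<close>

text \<open>The skew-symmetrised indicator of an oriented simplex. As a sum over all permutations it
  is skew-symmetric by mere reindexing.\<close>

definition basis_cochain :: "nat \<Rightarrow> 'v set \<Rightarrow> 'v list \<Rightarrow> real" where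
  "basis_cochain m \<sigma> xs = (\<Sum>p | p permutes {..<m}.
     if xs = permute_list p (orient \<sigma>) then real_of_int (sign p) else 0)"

lemma basis_cochain:
  assumes \<sigma>: "\<sigma> \<in> faces m"
  shows "basis_cochain m \<sigma> \<in> cochains X m"
  unfolding cochains_def
proof (intro CollectI conjI allI impI ballI)
  have o: "orient \<sigma> \<in> osimp X m" by (rule orient_osimp[OF \<sigma>])
  have len: "length (orient \<sigma>) = m" using o by (simp add: osimp_def)
  show "basis_cochain m \<sigma> xs = 0" if "xs \<notin> osimp X m" for xs
    using that permute_list_osimp[OF o] by (auto simp: basis_cochain_def intro!: sum.neutral)
  fix xs q assume xs: "xs \<in> osimp X m" and q: "q permutes {..<m}"
  have lenx: "length xs = m" using xs by (simp add: osimp_def)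
  have "basis_cochain m \<sigma> (permute_list q xs) = (\<Sum>p | p permutes {..<m}.
     if permute_list q xs = permute_list (p \<circ> q) (orient \<sigma>) then real_of_int (sign (p \<circ> q)) else 0)"
    unfolding basis_cochain_def by (rule sum_permutations_compose_right[OF q])
  also have "\<dots> = (\<Sum>p | p permutes {..<m}.
     real_of_int (sign q) * (if xs = permute_list p (orient \<sigma>) then real_of_int (sign p) else 0))"
  proof (intro sum.cong refl)
    fix p assume "p \<in> {p. p permutes {..<m}}"
    then have p: "p permutes {..<m}" by simp
    have "permute_list (p \<circ> q) (orient \<sigma>) = permute_list q (permute_list p (orient \<sigma>))"
      using permute_list_compose[of q "orient \<sigma>" p] q len by simp
    then have "permute_list q xs = permute_list (p \<circ> q) (orient \<sigma>) \<longleftrightarrow> xs = permute_list p (orient \<sigma>)"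
      using permute_list_inj[of q xs "permute_list p (orient \<sigma>)"] q lenx len by auto
    moreover have "sign (p \<circ> q) = sign p * sign q"
      using p q by (intro sign_compose) (auto intro: permutes_imp_permutation[OF finite_lessThan])
    ultimately show "(if permute_list q xs = permute_list (p \<circ> q) (orient \<sigma>)
        then real_of_int (sign (p \<circ> q)) else 0)
        = real_of_int (sign q) * (if xs = permute_list p (orient \<sigma>) then real_of_int (sign p) else 0)"
      by simp
  qed
  also have "\<dots> = real_of_int (sign q) * basis_cochain m \<sigma> xs"
    by (simp only: basis_cochain_def sum_distrib_left)
  finally show "basis_cochain m \<sigma> (permute_list q xs) = real_of_int (sign q) * basis_cochain m \<sigma> xs" .
qed

lemma basis_cochain_orient:
  assumes \<sigma>: "\<sigma> \<in> faces m" and \<tau>: "\<tau> \<in> faces m"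
  shows "basis_cochain m \<sigma> (orient \<tau>) = (if \<sigma> = \<tau> then 1 else 0)"
proof -
  have o: "orient \<sigma> \<in> osimp X m" by (rule orient_osimp[OF \<sigma>])
  have len: "length (orient \<sigma>) = m" and dist: "distinct (orient \<sigma>)" using o by (auto simp: osimp_def)
  have fin: "finite \<sigma>" "finite \<tau>" using \<sigma> \<tau> by (auto simp: faces_def)
  have "orient \<tau> = permute_list p (orient \<sigma>) \<longleftrightarrow> \<sigma> = \<tau> \<and> p = id" if p: "p permutes {..<m}" for p
  proof
    assume eq: "orient \<tau> = permute_list p (orient \<sigma>)"
    have "\<tau> = set (permute_list p (orient \<sigma>))" using orient(2)[OF fin(2)] eq by simp
    then have st: "\<sigma> = \<tau>" using orient(2)[OF fin(1)] p len by simp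
    have "p i = i" for i
    proof (cases "i < m")
      case True
      then have "orient \<sigma> ! i = orient \<sigma> ! p i"
        using eq st permute_list_nth[of p "orient \<sigma>" i] p len by simp
      then show ?thesis
        using True dist len permutes_in_image[OF p, of i] by (simp add: nth_eq_iff_index_eq)
    next
      case False
      then show ?thesis using permutes_not_in[OF p] by simp
    qed
    then show "\<sigma> = \<tau> \<and> p = id" using st by auto
  qed auto
  then have "basis_cochain m \<sigma> (orient \<tau>)
      = (\<Sum>p | p permutes {..<m}. if p = id then (if \<sigma> = \<tau> then 1 else 0) else 0)"
    unfolding basis_cochain_def by (intro sum.cong) (auto simp: sign_id)
  then show ?thesis
    by (simp add: finite_permutations permutes_id)
qed

text \<open>Pairing with an orthonormal basis reads off coordinates. This settles uniqueness of the
  adjoint and identifies the matrix entries of the Laplacian.\<close>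

lemma cinner_basis_cochain:
  assumes \<sigma>: "\<sigma> \<in> faces m"
  shows "cinner X m (basis_cochain m \<sigma>) \<psi> = \<psi> (orient \<sigma>)"
proof -
  have "cinner X m (basis_cochain m \<sigma>) \<psi>
      = (\<Sum>\<tau>\<in>faces m. (if \<sigma> = \<tau> then 1 else 0) * \<psi> (orient \<tau>))"
    unfolding cinner_def faces_def[symmetric]
    by (intro sum.cong refl) (simp add: basis_cochain_orient[OF \<sigma>])
  then show ?thesis
    using \<sigma> finite_faces[of m] by (simp add: if_distrib[of "\<lambda>x. x * _"] cong: if_cong)
qed

lemma cochain_expand:
  assumes "\<phi> \<in> cochains X m"
  shows "\<phi> = (\<lambda>xs. \<Sum>\<sigma>\<in>faces m. \<phi> (orient \<sigma>) * basis_cochain m \<sigma> xs)"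
proof (rule cochain_eqI[OF assms])
  show "(\<lambda>xs. \<Sum>\<sigma>\<in>faces m. \<phi> (orient \<sigma>) * basis_cochain m \<sigma> xs) \<in> cochains X m"
    by (intro cochains_lincomb finite_faces basis_cochain)
  fix \<tau> assume \<tau>: "\<tau> \<in> faces m"
  have "(\<Sum>\<sigma>\<in>faces m. \<phi> (orient \<sigma>) * basis_cochain m \<sigma> (orient \<tau>))
      = (\<Sum>\<sigma>\<in>faces m. if \<sigma> = \<tau> then \<phi> (orient \<sigma>) else 0)"
    by (intro sum.cong refl) (simp add: basis_cochain_orient \<tau>)
  then show "\<phi> (orient \<tau>) = (\<Sum>\<sigma>\<in>faces m. \<phi> (orient \<sigma>) * basis_cochain m \<sigma> (orient \<tau>))"
    using \<tau> finite_faces[of m] by simp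
qed

text \<open>Existence is \<open>oinner_cobd\<close> after cancelling the factorials. Uniqueness
  comes from testing against the basis cochains, which determines the value on each oriented
  simplex.\<close>

lemma cobd_adj_eq_cadj:
  assumes \<psi>: "\<psi> \<in> cochains X (Suc m)"
  shows "cobd_adj X m \<psi> = cadj X \<psi>"
  unfolding cobd_adj_def
proof (rule the_equality)
  have adj: "cinner X (Suc m) (cobd X m \<chi>) \<psi> = cinner X m \<chi> (cadj X \<psi>)" if "\<chi> \<in> cochains X m" for \<chi>
  proof -
    have "fact (Suc m) * cinner X (Suc m) (cobd X m \<chi>) \<psi> = fact (Suc m) * cinner X m \<chi> (cadj X \<psi>)"
      unfolding cinner_eq_oinner[OF cobd_cochain[OF that] \<psi>, symmetric] oinner_cobd[OF \<psi>]
        cinner_eq_oinner[OF that cadj_cochain[OF \<psi>]] by simp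
    then show ?thesis by (simp only: mult_cancel_left fact_nonzero simp_thms)
  qed
  show "cadj X \<psi> \<in> cochains X m \<and>
      (\<forall>\<chi>\<in>cochains X m. cinner X (Suc m) (cobd X m \<chi>) \<psi> = cinner X m \<chi> (cadj X \<psi>))"
    using cadj_cochain[OF \<psi>] adj by blast
  fix \<phi> assume \<phi>: "\<phi> \<in> cochains X m \<and>
      (\<forall>\<chi>\<in>cochains X m. cinner X (Suc m) (cobd X m \<chi>) \<psi> = cinner X m \<chi> \<phi>)"
  show "\<phi> = cadj X \<psi>"
  proof (rule cochain_eqI)
    fix \<sigma> assume \<sigma>: "\<sigma> \<in> faces m"
    note e = basis_cochain[OF \<sigma>]
    have "cinner X m (basis_cochain m \<sigma>) \<phi> = cinner X m (basis_cochain m \<sigma>) (cadj X \<psi>)"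
      using \<phi> e adj[OF e] by metis
    then show "\<phi> (orient \<sigma>) = cadj X \<psi> (orient \<sigma>)"
      by (simp add: cinner_basis_cochain[OF \<sigma>])
  qed (use \<phi> cadj_cochain[OF \<psi>] in auto)
qed

section \<open>The Laplacian and its symmetry\<close>

lemma laplacian_eq:
  assumes "\<phi> \<in> cochains X (Suc m)"
  shows "laplacian X (Suc m) \<phi> = (\<lambda>xs. cobd X m (cadj X \<phi>) xs + cadj X (cobd X (Suc m) \<phi>) xs)"
  using assms by (simp add: laplacian_def cobd_adj_eq_cadj cobd_cochain)

lemma laplacian_cochain:
  assumes "\<phi> \<in> cochains X (Suc m)"
  shows "laplacian X (Suc m) \<phi> \<in> cochains X (Suc m)"
proof -
  have "cobd X m (cadj X \<phi>) \<in> cochains X (Suc m)" "cadj X (cobd X (Suc m) \<phi>) \<in> cochains X (Suc m)"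
    by (intro cobd_cochain cadj_cochain assms)+
  then show ?thesis
    unfolding laplacian_eq[OF assms] by (auto simp: cochains_def distrib_left)
qed

lemma oinner_commute: "oinner X m \<phi> \<psi> = oinner X m \<psi> \<phi>"
  by (simp add: oinner_def mult.commute)

text \<open>Only the lower part is moved across by adjunction. The upper part stays as it is,
  because \<open>oinner_up_laplacian\<close> expands it pointwise.\<close>

lemma oinner_laplacian:
  assumes \<phi>: "\<phi> \<in> cochains X (Suc m)" and \<psi>: "\<psi> \<in> cochains X (Suc m)"
  shows "oinner X (Suc m) \<phi> (laplacian X (Suc m) \<psi>)
    = real (Suc m) * oinner X m (cadj X \<phi>) (cadj X \<psi>)
      + oinner X (Suc m) \<phi> (cadj X (cobd X (Suc m) \<psi>))"
proof -
  have "oinner X (Suc m) \<phi> (laplacian X (Suc m) \<psi>)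
      = oinner X (Suc m) (cobd X m (cadj X \<psi>)) \<phi> + oinner X (Suc m) \<phi> (cadj X (cobd X (Suc m) \<psi>))"
    unfolding laplacian_eq[OF \<psi>] by (simp add: oinner_def algebra_simps sum.distrib)
  then show ?thesis
    unfolding oinner_cobd[OF \<phi>] by (simp add: oinner_commute)
qed

lemma laplacian_self_adjoint:
  assumes \<phi>: "\<phi> \<in> cochains X (Suc m)" and \<psi>: "\<psi> \<in> cochains X (Suc m)"
  shows "cinner X (Suc m) \<phi> (laplacian X (Suc m) \<psi>) = cinner X (Suc m) \<psi> (laplacian X (Suc m) \<phi>)"
proof -
  have "real (Suc (Suc m)) * oinner X (Suc m) \<phi> (cadj X (cobd X (Suc m) \<psi>))
      = real (Suc (Suc m)) * oinner X (Suc m) \<psi> (cadj X (cobd X (Suc m) \<phi>))"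
    using oinner_cobd[OF cobd_cochain[OF \<psi>], of \<phi>] oinner_cobd[OF cobd_cochain[OF \<phi>], of \<psi>]
    by (simp only: oinner_commute[of _ "cobd X (Suc m) \<phi>"])
  then have "oinner X (Suc m) \<phi> (laplacian X (Suc m) \<psi>) = oinner X (Suc m) \<psi> (laplacian X (Suc m) \<phi>)"
    unfolding oinner_laplacian[OF \<phi> \<psi>] oinner_laplacian[OF \<psi> \<phi>]
    by (simp add: oinner_commute[of m])
  then show ?thesis
    using cinner_eq_oinner \<phi> \<psi> laplacian_cochain by simp
qed

end

section \<open>Spectrum of the Laplacian\<close>

text \<open>Nonemptiness of the spectrum holds over the complex numbers. A Hermitian matrix has real
  eigenvalues, and for a real matrix the real and imaginary parts of an eigenvector satisfy the same
  equation; at least one of them is nonzero.\<close>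

lemma real_symmetric_has_eigenvalue:
  fixes M :: "real mat"
  assumes M: "M \<in> carrier_mat n n" and n: "n > 0"
    and sym: "\<And>i j. i < n \<Longrightarrow> j < n \<Longrightarrow> M $$ (i, j) = M $$ (j, i)"
  shows "\<exists>e. eigenvalue M e"
proof -
  let ?C = "map_mat complex_of_real M"
  have C: "?C \<in> carrier_mat n n" using M by simp
  obtain a where "a \<in> spectrum ?C" using spectrum_non_empty[OF C n] by blast
  then obtain v where v: "v \<in> carrier_vec n" "v \<noteq> 0\<^sub>v n" "?C *\<^sub>v v = a \<cdot>\<^sub>v v"
    using C by (auto simp: spectrum_def eigenvalue_def eigenvector_def)
  have "mat_adjoint ?C = ?C"
    using M sym by (intro eq_matI) auto
  then have "(?C *\<^sub>v v) \<bullet>c v = v \<bullet>c (?C *\<^sub>v v)"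
    using cscalar_mult_mat_vec[OF C v(1) v(1)] by simp
  moreover have "v \<bullet>c (a \<cdot>\<^sub>v v) = cnj a * (v \<bullet>c v)"
    using v(1) by (simp add: scalar_prod_def sum_distrib_left mult_ac)
  ultimately have "(a - cnj a) * (v \<bullet>c v) = 0"
    using v by (simp add: left_diff_distrib)
  then have "a = cnj a"
    using cscalar_self_eq_0[OF v(1)] v(2) by auto
  then have a: "Im a = 0" by (simp add: complex_eq_iff)
  have Mv: "(\<Sum>j = 0..<n. complex_of_real (M $$ (i, j)) * v $ j) = a * v $ i" if i: "i < n" for i
  proof -
    have "(?C *\<^sub>v v) $ i = (\<Sum>j = 0..<n. complex_of_real (M $$ (i, j)) * v $ j)"
      using i M v(1) by (auto simp: scalar_prod_def)
    then show ?thesis using v i by simp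
  qed
  define x y where "x = vec n (\<lambda>i. Re (v $ i))" and "y = vec n (\<lambda>i. Im (v $ i))"
  have "M *\<^sub>v x = Re a \<cdot>\<^sub>v x"
  proof (rule eq_vecI)
    fix i assume "i < dim_vec (Re a \<cdot>\<^sub>v x)"
    then have i: "i < n" by (simp add: x_def)
    have "(M *\<^sub>v x) $ i = Re (\<Sum>j = 0..<n. complex_of_real (M $$ (i, j)) * v $ j)"
      using i M by (auto simp: scalar_prod_def x_def)
    then show "(M *\<^sub>v x) $ i = (Re a \<cdot>\<^sub>v x) $ i" using i a by (simp add: Mv x_def)
  qed (use M in \<open>simp add: x_def\<close>)
  moreover have "M *\<^sub>v y = Re a \<cdot>\<^sub>v y"
  proof (rule eq_vecI)
    fix i assume "i < dim_vec (Re a \<cdot>\<^sub>v y)"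
    then have i: "i < n" by (simp add: y_def)
    have "(M *\<^sub>v y) $ i = Im (\<Sum>j = 0..<n. complex_of_real (M $$ (i, j)) * v $ j)"
      using i M by (auto simp: scalar_prod_def y_def)
    then show "(M *\<^sub>v y) $ i = (Re a \<cdot>\<^sub>v y) $ i" using i a by (simp add: Mv y_def)
  qed (use M in \<open>simp add: y_def\<close>)
  moreover have "x \<noteq> 0\<^sub>v n \<or> y \<noteq> 0\<^sub>v n"
  proof (rule ccontr)
    assume "\<not> (x \<noteq> 0\<^sub>v n \<or> y \<noteq> 0\<^sub>v n)"
    then have xy: "x = 0\<^sub>v n" "y = 0\<^sub>v n" by auto
    have "v $ i = 0" if i: "i < n" for i
    proof -
      have "x $ i = 0" "y $ i = 0" using xy i by simp_all
      then show ?thesis using i by (simp add: x_def y_def complex_eq_iff)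
    qed
    then have "v = 0\<^sub>v n" using v(1) by (intro eq_vecI) auto
    then show False using v(2) by simp
  qed
  ultimately show ?thesis
    using M unfolding eigenvalue_def eigenvector_def
    by (metis x_def y_def carrier_matD(1) vec_carrier)
qed

context simplicial_complex
begin

lemma laplacian_lincomb:
  assumes I: "finite I" and e: "\<And>i. i \<in> I \<Longrightarrow> e i \<in> cochains X (Suc m)"
  shows "laplacian X (Suc m) (\<lambda>xs. \<Sum>i\<in>I. c i * e i xs)
    = (\<lambda>xs. \<Sum>i\<in>I. c i * laplacian X (Suc m) (e i) xs)"
proof -
  have cadj: "cadj X (\<lambda>xs. \<Sum>i\<in>I. c i * f i xs) = (\<lambda>xs. \<Sum>i\<in>I. c i * cadj X (f i) xs)" for f :: "_ \<Rightarrow> 'v list \<Rightarrow> real"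
    unfolding cadj_def by (auto simp: sum_distrib_left intro: sum.swap)
  have cobd: "cobd X l (\<lambda>xs. \<Sum>i\<in>I. c i * f i xs) = (\<lambda>xs. \<Sum>i\<in>I. c i * cobd X l (f i) xs)" for f :: "_ \<Rightarrow> 'v list \<Rightarrow> real" and l
  proof
    fix xs
    have "(\<Sum>j<Suc l. (- 1) ^ j * (\<Sum>i\<in>I. c i * f i (take j xs @ drop (Suc j) xs)))
        = (\<Sum>j<Suc l. \<Sum>i\<in>I. c i * ((- 1) ^ j * f i (take j xs @ drop (Suc j) xs)))"
      by (intro sum.cong refl) (simp add: sum_distrib_left mult.left_commute)
    also have "\<dots> = (\<Sum>i\<in>I. \<Sum>j<Suc l. c i * ((- 1) ^ j * f i (take j xs @ drop (Suc j) xs)))"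
      by (rule sum.swap)
    finally show "cobd X l (\<lambda>xs. \<Sum>i\<in>I. c i * f i xs) xs = (\<Sum>i\<in>I. c i * cobd X l (f i) xs)"
      by (simp only: cobd_def sum_distrib_left if_distrib mult_zero_right sum.neutral_const cong: if_cong)
        (auto simp: sum_distrib_left)
  qed
  have "(\<lambda>xs. \<Sum>i\<in>I. c i * laplacian X (Suc m) (e i) xs)
      = (\<lambda>xs. \<Sum>i\<in>I. c i * (cobd X m (cadj X (e i)) xs + cadj X (cobd X (Suc m) (e i)) xs))"
    using e by (intro ext sum.cong refl) (simp add: laplacian_eq)
  moreover have "(\<lambda>xs. \<Sum>i\<in>I. c i * e i xs) \<in> cochains X (Suc m)"
    by (rule cochains_lincomb[OF I e])
  ultimately show ?thesis
    by (simp add: laplacian_eq cadj cobd distrib_left sum.distrib)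
qed

text \<open>Needed because \<open>spectral_gap\<close> is a \<open>Min\<close>. In the basis of
  cochains the Laplacian becomes a matrix M with the same eigenvalues; a matrix has finitely many,
  and a symmetric real one has at least one.\<close>

lemma lap_eigenvalues_finite_nonempty:
  assumes ne: "faces (Suc m) \<noteq> {}"
  shows "finite (lap_eigenvalues X (Suc m))" "lap_eigenvalues X (Suc m) \<noteq> {}"
proof -
  define N where "N = card (faces (Suc m))"
  obtain s where s: "bij_betw s {0..<N} (faces (Suc m))"
    using ex_bij_betw_nat_finite[OF finite_faces] N_def by blast
  have sN: "s i \<in> faces (Suc m)" if "i < N" for i using bij_betwE[OF s] that by simp
  have N: "N > 0" using ne finite_faces by (auto simp: N_def card_gt_0_iff)
  let ?L = "laplacian X (Suc m)" and ?e = "\<lambda>i. basis_cochain (Suc m) (s i)"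
  define M where "M = mat N N (\<lambda>(i, j). ?L (?e j) (orient (s i)))"
  have M: "M \<in> carrier_mat N N" by (simp add: M_def)
  have expand: "\<phi> = (\<lambda>xs. \<Sum>i = 0..<N. \<phi> (orient (s i)) * ?e i xs)"
    if "\<phi> \<in> cochains X (Suc m)" for \<phi>
    using cochain_expand[OF that]
      sum.reindex_bij_betw[OF s, of "\<lambda>\<sigma>. \<phi> (orient \<sigma>) * basis_cochain (Suc m) \<sigma> _"] by simp
  have eq0I: "\<phi> = \<psi>" if "\<phi> \<in> cochains X (Suc m)" "\<psi> \<in> cochains X (Suc m)"
    "\<And>i. i < N \<Longrightarrow> \<phi> (orient (s i)) = \<psi> (orient (s i))" for \<phi> \<psi>
    using that(1,2)
  proof (rule cochain_eqI)
    fix \<sigma> assume "\<sigma> \<in> faces (Suc m)"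
    then have "\<sigma> \<in> s ` {0..<N}" using s by (simp add: bij_betw_def)
    then show "\<phi> (orient \<sigma>) = \<psi> (orient \<sigma>)" using that(3) by auto
  qed
  have LM: "?L \<phi> (orient (s i)) = (M *\<^sub>v vec N (\<lambda>j. \<phi> (orient (s j)))) $ i"
    if \<phi>: "\<phi> \<in> cochains X (Suc m)" and i: "i < N" for \<phi> i
  proof -
    have "?L \<phi> = (\<lambda>xs. \<Sum>j = 0..<N. \<phi> (orient (s j)) * ?L (?e j) xs)"
      by (subst expand[OF \<phi>], rule laplacian_lincomb) (auto intro: basis_cochain sN)
    then show ?thesis using i by (simp add: M_def scalar_prod_def mult.commute)
  qed
  have smult: "(\<lambda>xs. e * \<phi> xs) \<in> cochains X (Suc m)" if "\<phi> \<in> cochains X (Suc m)" for e \<phi>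
    using cochains_lincomb[of "{()}" "\<lambda>_. \<phi>" X "Suc m" "\<lambda>_. e"] that by simp
  have "e \<in> lap_eigenvalues X (Suc m) \<longleftrightarrow> eigenvalue M e" for e
  proof
    assume "e \<in> lap_eigenvalues X (Suc m)"
    then obtain \<phi> where \<phi>: "\<phi> \<in> cochains X (Suc m)" "\<phi> \<noteq> (\<lambda>_. 0)" "?L \<phi> = (\<lambda>xs. e * \<phi> xs)"
      by (auto simp: lap_eigenvalues_def)
    let ?x = "vec N (\<lambda>j. \<phi> (orient (s j)))"
    have "?x \<noteq> 0\<^sub>v N"
    proof
      assume x0: "?x = 0\<^sub>v N"
      have "\<phi> (orient (s i)) = 0" if "i < N" for i
      proof -
        have "?x $ i = 0" using x0 that by simp
        then show ?thesis using that by simp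
      qed
      then have "\<phi> = (\<lambda>_. 0)" by (intro eq0I \<phi>) (auto simp: cochains_def)
      then show False using \<phi>(2) by simp
    qed
    moreover have "M *\<^sub>v ?x = e \<cdot>\<^sub>v ?x"
    proof (rule eq_vecI)
      fix i assume "i < dim_vec (e \<cdot>\<^sub>v ?x)"
      then have i: "i < N" by simp
      show "(M *\<^sub>v ?x) $ i = (e \<cdot>\<^sub>v ?x) $ i"
        unfolding LM[OF \<phi>(1) i, symmetric] \<phi>(3) using i by simp
    qed (simp add: M_def)
    ultimately show "eigenvalue M e"
      unfolding eigenvalue_def eigenvector_def using M by (intro exI[of _ ?x]) auto
  next
    assume "eigenvalue M e"
    then obtain x where x: "x \<in> carrier_vec N" "x \<noteq> 0\<^sub>v N" "M *\<^sub>v x = e \<cdot>\<^sub>v x"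
      using M by (auto simp: eigenvalue_def eigenvector_def)
    define \<phi> where "\<phi> = (\<lambda>xs. \<Sum>i = 0..<N. x $ i * ?e i xs)"
    have \<phi>: "\<phi> \<in> cochains X (Suc m)"
      unfolding \<phi>_def by (intro cochains_lincomb) (auto intro: basis_cochain sN)
    have \<phi>s: "\<phi> (orient (s j)) = x $ j" if j: "j < N" for j
    proof -
      have "\<phi> (orient (s j)) = (\<Sum>i = 0..<N. if i = j then x $ i else 0)"
        unfolding \<phi>_def
      proof (intro sum.cong refl)
        fix i assume "i \<in> {0..<N}"
        then have "s i = s j \<longleftrightarrow> i = j" using s j by (auto simp: bij_betw_def inj_on_def)
        then show "x $ i * ?e i (orient (s j)) = (if i = j then x $ i else 0)"
          using \<open>i \<in> {0..<N}\<close> j by (simp add: basis_cochain_orient sN)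
      qed
      then show ?thesis using j by simp
    qed
    have vec: "vec N (\<lambda>j. \<phi> (orient (s j))) = x"
      using x(1) by (intro eq_vecI) (auto simp: \<phi>s)
    have "?L \<phi> = (\<lambda>xs. e * \<phi> xs)"
    proof (rule eq0I[OF laplacian_cochain[OF \<phi>] smult[OF \<phi>]])
      fix i assume i: "i < N"
      show "?L \<phi> (orient (s i)) = e * \<phi> (orient (s i))"
        unfolding LM[OF \<phi> i] vec x(3) using x(1) i by (simp add: \<phi>s)
    qed
    moreover have "\<phi> \<noteq> (\<lambda>_. 0)"
      using x(2) vec by (auto simp: zero_vec_def)
    ultimately show "e \<in> lap_eigenvalues X (Suc m)"
      using \<phi> by (auto simp: lap_eigenvalues_def)
  qed
  then have eq: "lap_eigenvalues X (Suc m) = {e. eigenvalue M e}" by blast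
  show "finite (lap_eigenvalues X (Suc m))"
    using card_finite_spectrum(1)[OF M] by (simp add: eq spectrum_def)
  \<comment> \<open>The basis is orthonormal, so an entry of M is the inner product of one basis
    cochain with the Laplacian of another.\<close>
  have "M $$ (i, j) = M $$ (j, i)" if "i < N" "j < N" for i j
    using laplacian_self_adjoint[OF basis_cochain[OF sN[OF that(1)]] basis_cochain[OF sN[OF that(2)]]]
      that by (simp add: M_def cinner_basis_cochain[OF sN])
  then show "lap_eigenvalues X (Suc m) \<noteq> {}"
    using real_symmetric_has_eigenvalue[OF M N] by (auto simp: eq)
qed

section \<open>The upper Laplacian as degree minus adjacency\<close>

text \<open>Among the facets of \<open>v # zs\<close>, the one without v gives the degree term. Any
  other one loses a vertex w of \<open>zs\<close>; with w moved to the front the signs cancel, and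
  the term pairs two simplices \<open>w # ys\<close> and \<open>v # ys\<close> over a common facet.
  The factor counts the positions of w.\<close>

lemma oinner_up_laplacian:
  assumes \<phi>: "\<phi> \<in> cochains X (Suc m)"
  shows "oinner X (Suc m) \<phi> (cadj X (cobd X (Suc m) \<phi>))
    = (\<Sum>zs\<in>osimp X (Suc m). real (card {v. v # zs \<in> osimp X (Suc (Suc m))}) * (\<phi> zs)\<^sup>2)
      - real (Suc m) * (\<Sum>ys\<in>osimp X m. \<Sum>w\<in>\<Union>X. \<Sum>v\<in>\<Union>X.
          if v # w # ys \<in> osimp X (Suc (Suc m)) then \<phi> (w # ys) * \<phi> (v # ys) else 0)"
proof -
  let ?O = "osimp X (Suc (Suc m))"
  \<comment> \<open>The lost vertex stands at the head of the argument and \<open>tl\<close> is the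
    common facet, so that \<open>sum_osimp_move_front\<close> can remove the dependence on the
    position.\<close>
  define H where "H zs = (\<Sum>v\<in>\<Union>X. if v # zs \<in> ?O then \<phi> zs * \<phi> (v # tl zs) else 0)" for zs
  have pt: "\<phi> zs * cadj X (cobd X (Suc m) \<phi>) zs
      = real (card {v. v # zs \<in> ?O}) * (\<phi> zs)\<^sup>2 - (\<Sum>i<Suc m. H (zs ! i # omit i zs))"
    if zs: "zs \<in> osimp X (Suc m)" for zs
  proof -
    have len: "length zs = Suc m" using zs by (simp add: osimp_def)
    have "\<phi> zs * cobd X (Suc m) \<phi> (v # zs) = (if v # zs \<in> ?O then (\<phi> zs)\<^sup>2 else 0)
        - (\<Sum>i<Suc m. if v # zs \<in> ?O then \<phi> (zs ! i # omit i zs) * \<phi> (v # omit i zs) else 0)" for v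
    proof (cases "v # zs \<in> ?O")
      case True
      \<comment> \<open>Prepending v shifts the positions in \<open>zs\<close> by one, which turns
        their signs around.\<close>
      have "cobd X (Suc m) \<phi> (v # zs) = \<phi> zs - (\<Sum>i<Suc m. (- 1) ^ i * \<phi> (v # omit i zs))"
        unfolding cobd_osimp[OF True] sum.lessThan_Suc_shift[of _ "Suc m"]
        by (simp add: omit_def sum_negf del: sum.lessThan_Suc)
      then have "\<phi> zs * cobd X (Suc m) \<phi> (v # zs)
          = (\<phi> zs)\<^sup>2 - (\<Sum>i<Suc m. \<phi> zs * ((- 1) ^ i * \<phi> (v # omit i zs)))"
        by (simp only: right_diff_distrib sum_distrib_left power2_eq_square)
      also have "(\<Sum>i<Suc m. \<phi> zs * ((- 1) ^ i * \<phi> (v # omit i zs)))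
          = (\<Sum>i<Suc m. \<phi> (zs ! i # omit i zs) * \<phi> (v # omit i zs))"
        by (intro sum.cong refl) (simp add: cochains_move_front[OF \<phi> zs])
      finally show ?thesis using True by simp
    qed (simp add: cobd_def)
    then have "\<phi> zs * cadj X (cobd X (Suc m) \<phi>) zs = (\<Sum>v\<in>\<Union>X. if v # zs \<in> ?O then (\<phi> zs)\<^sup>2 else 0)
        - (\<Sum>v\<in>\<Union>X. \<Sum>i<Suc m. if v # zs \<in> ?O then \<phi> (zs ! i # omit i zs) * \<phi> (v # omit i zs) else 0)"
      by (simp only: cadj_def sum_distrib_left sum_subtractf)
    also have "(\<Sum>v\<in>\<Union>X. if v # zs \<in> ?O then (\<phi> zs)\<^sup>2 else 0)
        = (\<Sum>v\<in>{v\<in>\<Union>X. v # zs \<in> ?O}. (\<phi> zs)\<^sup>2)"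
      by (rule sum.inter_filter[symmetric]) (rule finite_vertices)
    also have "{v\<in>\<Union>X. v # zs \<in> ?O} = {v. v # zs \<in> ?O}"
      using osimp_Cons by blast
    also have "(\<Sum>v\<in>\<Union>X. \<Sum>i<Suc m. if v # zs \<in> ?O then \<phi> (zs ! i # omit i zs) * \<phi> (v # omit i zs) else 0)
        = (\<Sum>i<Suc m. \<Sum>v\<in>\<Union>X. if v # zs \<in> ?O then \<phi> (zs ! i # omit i zs) * \<phi> (v # omit i zs) else 0)"
      by (rule sum.swap)
    also have "\<dots> = (\<Sum>i<Suc m. H (zs ! i # omit i zs))"
      unfolding H_def
    proof (intro sum.cong refl)
      fix i v assume "i \<in> {..<Suc m}"
      then have ms: "mset (v # zs ! i # omit i zs) = mset (v # zs)" using mset_omit[of i zs] len by simp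
      have "v # zs \<in> ?O \<longleftrightarrow> v # zs ! i # omit i zs \<in> ?O"
        using mset_eq_imp_distinct_iff[OF ms] mset_eq_setD[OF ms] mset_eq_length[OF ms]
        unfolding osimp_def by (simp only: mem_Collect_eq)
      then show "(if v # zs \<in> ?O then \<phi> (zs ! i # omit i zs) * \<phi> (v # omit i zs) else 0)
          = (if v # zs ! i # omit i zs \<in> ?O then \<phi> (zs ! i # omit i zs) * \<phi> (v # tl (zs ! i # omit i zs)) else 0)"
        by simp
    qed
    finally show ?thesis by simp
  qed
  have "(\<Sum>zs\<in>osimp X (Suc m). \<Sum>i<Suc m. H (zs ! i # omit i zs))
      = (\<Sum>i<Suc m. \<Sum>zs\<in>osimp X (Suc m). H (zs ! i # omit i zs))"
    by (rule sum.swap)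
  also have "\<dots> = (\<Sum>i<Suc m. \<Sum>zs\<in>osimp X (Suc m). H zs)"
    by (intro sum.cong refl sum_osimp_move_front) simp
  also have "(\<Sum>zs\<in>osimp X (Suc m). H zs) = (\<Sum>ys\<in>osimp X m. \<Sum>w\<in>\<Union>X. H (w # ys))"
    by (rule sum_osimp_Suc) (auto simp: H_def cochains_eq_0[OF \<phi>] intro!: sum.neutral)
  finally have "(\<Sum>zs\<in>osimp X (Suc m). \<Sum>i<Suc m. H (zs ! i # omit i zs))
      = real (Suc m) * (\<Sum>ys\<in>osimp X m. \<Sum>w\<in>\<Union>X. H (w # ys))" by simp
  then show ?thesis
    unfolding oinner_def by (simp only: pt sum_subtractf H_def list.sel cong: sum.cong)
qed

end

section \<open>The complexes on the join\<close>

lemma gprod_closed: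
  assumes "group G" "set xs \<subseteq> carrier G"
  shows "gprod G xs \<in> carrier G"
proof -
  interpret group G by fact
  show ?thesis using assms(2) by (induction xs) (auto simp: gprod_def)
qed

lemma gprod_append:
  assumes "group G" "set xs \<subseteq> carrier G" "set ys \<subseteq> carrier G"
  shows "gprod G (xs @ ys) = gprod G xs \<otimes>\<^bsub>G\<^esub> gprod G ys"
proof -
  interpret group G by fact
  show ?thesis
    using assms(2)
  proof (induction xs)
    case Nil
    then show ?case using gprod_closed[OF assms(1,3)] by (simp add: gprod_def)
  next
    case (Cons x xs)
    then show ?case
      using gprod_closed[OF assms(1), of xs] gprod_closed[OF assms(1,3)]
      by (simp add: gprod_def m_assoc)
  qed
qed

lemma gprod_split:
  assumes "group G" "l \<le> i" "i < r" "f ` {l..<r} \<subseteq> carrier G"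
  shows "gprod G (map f [l..<r])
    = gprod G (map f [l..<i]) \<otimes>\<^bsub>G\<^esub> (f i \<otimes>\<^bsub>G\<^esub> gprod G (map f [Suc i..<r]))"
proof -
  have "[l..<r] = [l..<i] @ i # [Suc i..<r]"
    using assms(2,3) by (metis le_add_diff_inverse less_imp_le upt_add_eq_append upt_conv_Cons)
  then have "gprod G (map f [l..<r]) = gprod G (map f [l..<i] @ f i # map f [Suc i..<r])" by simp
  also have "\<dots> = gprod G (map f [l..<i]) \<otimes>\<^bsub>G\<^esub> gprod G (f i # map f [Suc i..<r])"
    using assms by (intro gprod_append) (auto simp: image_subset_iff)
  finally show ?thesis by (simp add: gprod_def)
qed

text \<open>A proper face has at most k vertices and the skeleton is full, so the product condition
  never has to be checked on it.\<close>

lemma Ycomplex_simplicial: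
  assumes "finite (carrier G)"
  shows "simplicial_complex (Ycomplex G A k)"
proof
  have fin: "finite ({1..Suc k} \<times> carrier G)" using assms by simp
  show "finite (\<Union> (Ycomplex G A k))"
    by (rule finite_subset[OF _ fin]) (auto simp: Ycomplex_def)
  fix \<sigma> \<tau> assume \<sigma>: "\<sigma> \<in> Ycomplex G A k" and \<tau>: "\<tau> \<subseteq> \<sigma>"
  have fin\<sigma>: "finite \<sigma>" using \<sigma> finite_subset[OF _ fin] by (auto simp: Ycomplex_def)
  show "\<tau> \<in> Ycomplex G A k"
  proof (cases "\<tau> = \<sigma>")
    case False
    then have "card \<tau> < card \<sigma>" using \<tau> fin\<sigma> by (intro psubset_card_mono) auto
    moreover have "card \<sigma> \<le> Suc k" using \<sigma> by (auto simp: Ycomplex_def)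
    ultimately have "card \<tau> \<le> k" by simp
    then show ?thesis using \<sigma> \<tau> unfolding Ycomplex_def by blast
  qed (use \<sigma> in simp)
qed

lemma Ycomplex_inj_on: "\<sigma> \<in> Ycomplex G A k \<Longrightarrow> inj_on fst \<sigma>"
  by (rule inj_onI) (auto simp: Ycomplex_def)

lemma Ycomplex_card_le:
  "card \<sigma> \<le> k \<Longrightarrow> \<sigma> \<in> Ycomplex G A k \<longleftrightarrow>
    \<sigma> \<subseteq> {1..Suc k} \<times> carrier G \<and> inj_on fst \<sigma>"
  by (force simp: Ycomplex_def inj_on_def)

lemma Ycomplex_card_Suc:
  "card \<sigma> = Suc k \<Longrightarrow> \<sigma> \<in> Ycomplex G A k \<longleftrightarrow>
    \<sigma> \<subseteq> {1..Suc k} \<times> carrier G \<and> inj_on fst \<sigma> \<and>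
    gprod G (map (\<lambda>i. THE x. (i, x) \<in> \<sigma>) [1..<k + 2]) \<in> A"
  by (force simp: Ycomplex_def inj_on_def)

section \<open>Links of (k-2)-simplices\<close>

text \<open>Here k = \<open>Suc n\<close>, so n vertices leave two of the n + 2 levels free. The
  elements a, b, c are the products of the labels below the lower free level, between the two, and
  above the upper one. Ordered simplices list the two new vertices in either order, hence the
  disjunction.\<close>

lemma Ycomplex_link:
  assumes "group G" and ys: "ys \<in> osimp (Ycomplex G A (Suc n)) n"
  obtains i j a b c where "i \<noteq> j" "a \<in> carrier G" "b \<in> carrier G" "c \<in> carrier G"
    "\<forall>v. v # ys \<in> osimp (Ycomplex G A (Suc n)) (Suc n) \<longleftrightarrow> v \<in> {i, j} \<times> carrier G"
    "\<forall>v w. v # w # ys \<in> osimp (Ycomplex G A (Suc n)) (Suc (Suc n)) \<longleftrightarrow>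
      (\<exists>g\<in>carrier G. \<exists>h\<in>carrier G. a \<otimes>\<^bsub>G\<^esub> (g \<otimes>\<^bsub>G\<^esub> (b \<otimes>\<^bsub>G\<^esub> (h \<otimes>\<^bsub>G\<^esub> c))) \<in> A \<and>
        (v = (i, g) \<and> w = (j, h) \<or> w = (i, g) \<and> v = (j, h)))"
proof -
  interpret group G by fact
  let ?Y = "Ycomplex G A (Suc n)" and ?I = "{1..Suc (Suc n)}" and ?C = "carrier G"
  define L where "L = fst ` set ys"
  have len: "length ys = n" "distinct ys" using ys by (auto simp: osimp_def)
  have Y: "set ys \<subseteq> ?I \<times> ?C" "inj_on fst (set ys)"
    using ys Ycomplex_card_le[of "set ys" "Suc n" G A] len by (auto simp: osimp_def distinct_card)
  have L: "L \<subseteq> ?I" "card L = n" "finite L"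
    using Y len by (auto simp: L_def card_image distinct_card)
  have "card (?I - L) = 2" using L by (simp add: card_Diff_subset)
  then obtain i' j' where ij': "?I - L = {i', j'}" "i' \<noteq> j'" by (auto simp: card_2_iff)
  \<comment> \<open>The product runs through the levels in increasing order, so the lower free level
    has to carry the left factor g.\<close>
  define i j where "i = min i' j'" and "j = max i' j'"
  have ij: "?I - L = {i, j}" "i < j" using ij' by (auto simp: i_def j_def min_def max_def)
  have iL: "i \<notin> L" "j \<notin> L" "i \<in> ?I" "j \<in> ?I" using ij by auto
  have I: "?I = insert i (insert j L)" using ij(1) L(1) by blast
  define z where "z l = (THE x. (l, x) \<in> set ys)" for l
  have z: "(l, x) \<in> set ys \<longleftrightarrow> x = z l" if l: "l \<in> L" for l x
  proof -
    obtain y where y: "(l, y) \<in> set ys" using l by (auto simp: L_def)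
    have u: "x = y" if "(l, x) \<in> set ys" for x
      using inj_onD[OF Y(2) _ that y] by simp
    then have "z l = y" unfolding z_def using y by blast
    then show ?thesis using u y by blast
  qed
  have zC: "z l \<in> ?C" if l: "l \<in> L" for l
    using z[OF l, of "z l"] Y(1) by auto
  define a where "a = gprod G (map z [1..<i])"
  define b where "b = gprod G (map z [Suc i..<j])"
  define c where "c = gprod G (map z [Suc j..<Suc n + 2])"
  have rng: "set (map z [1..<i]) \<subseteq> ?C" "set (map z [Suc i..<j]) \<subseteq> ?C"
      "set (map z [Suc j..<Suc n + 2]) \<subseteq> ?C"
  proof -
    have "l \<in> L" if "l \<in> {1..<i} \<union> {Suc i..<j} \<union> {Suc j..<Suc n + 2}" for l
    proof -
      have "l \<in> ?I" "l \<noteq> i" "l \<noteq> j" using that ij(2) iL(3,4) by auto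
      then show ?thesis using ij(1) by blast
    qed
    then show "set (map z [1..<i]) \<subseteq> ?C" "set (map z [Suc i..<j]) \<subseteq> ?C"
      "set (map z [Suc j..<Suc n + 2]) \<subseteq> ?C"
      using zC by (auto simp del: upt_Suc)
  qed
  have abc: "a \<in> ?C" "b \<in> ?C" "c \<in> ?C"
    unfolding a_def b_def c_def by (intro gprod_closed assms(1) rng)+
  have one: "v # ys \<in> osimp ?Y (Suc n) \<longleftrightarrow> v \<in> {i, j} \<times> ?C" for v
  proof -
    have "v # ys \<in> osimp ?Y (Suc n) \<longleftrightarrow>
        v \<notin> set ys \<and> insert v (set ys) \<subseteq> ?I \<times> ?C \<and> inj_on fst (insert v (set ys))"
    proof (cases "v \<in> set ys")
      case False
      then have "card (insert v (set ys)) = Suc n" using len by (simp add: distinct_card)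
      then have "insert v (set ys) \<in> ?Y \<longleftrightarrow>
          insert v (set ys) \<subseteq> ?I \<times> ?C \<and> inj_on fst (insert v (set ys))"
        by (intro Ycomplex_card_le) simp
      then show ?thesis using False len by (simp add: osimp_def)
    qed (simp add: osimp_def)
    also have "\<dots> \<longleftrightarrow> v \<in> ?I \<times> ?C \<and> fst v \<notin> L"
      using Y by (auto simp: L_def inj_on_insert)
    also have "\<dots> \<longleftrightarrow> v \<in> {i, j} \<times> ?C"
      unfolding ij(1)[symmetric] by (cases v) auto
    finally show ?thesis .
  qed
  let ?S = "\<lambda>g h. insert (i, g) (insert (j, h) (set ys))"
  have prod: "gprod G (map (\<lambda>l. THE x. (l, x) \<in> ?S g h) [1..<Suc n + 2])
      = a \<otimes>\<^bsub>G\<^esub> (g \<otimes>\<^bsub>G\<^esub> (b \<otimes>\<^bsub>G\<^esub> (h \<otimes>\<^bsub>G\<^esub> c)))"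
    if gh: "g \<in> ?C" "h \<in> ?C" for g h
  proof -
    define f where "f l = (THE x. (l, x) \<in> ?S g h)" for l
    have iys: "(i, x) \<notin> set ys" "(j, x) \<notin> set ys" for x
      using iL by (force simp: L_def)+
    have f: "f i = g" "f j = h" using ij(2) iys by (auto simp: f_def)
    have fz: "f l = z l" if "l \<noteq> i" "l \<noteq> j" for l using that by (simp add: f_def z_def)
    have fC: "f l \<in> ?C" if "l \<in> ?I" for l
      using that gh f fz zC unfolding I by (cases "l = i"; cases "l = j") auto
    have "gprod G (map f [1..<Suc n + 2])
        = gprod G (map f [1..<i]) \<otimes>\<^bsub>G\<^esub> (f i \<otimes>\<^bsub>G\<^esub> gprod G (map f [Suc i..<Suc n + 2]))"
      using iL(3) fC by (intro gprod_split assms(1)) auto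
    also have "gprod G (map f [Suc i..<Suc n + 2])
        = gprod G (map f [Suc i..<j]) \<otimes>\<^bsub>G\<^esub> (f j \<otimes>\<^bsub>G\<^esub> gprod G (map f [Suc j..<Suc n + 2]))"
      using iL(3,4) ij(2) fC by (intro gprod_split assms(1)) auto
    also have "map f [1..<i] = map z [1..<i]" using ij(2) by (auto intro!: fz)
    also have "map f [Suc i..<j] = map z [Suc i..<j]" by (auto intro!: fz)
    also have "map f [Suc j..<Suc n + 2] = map z [Suc j..<Suc n + 2]"
      using ij(2) by (auto intro!: fz simp del: upt_Suc)
    finally show ?thesis by (simp only: f a_def b_def c_def f_def[symmetric])
  qed
  have mem: "?S g h \<in> ?Y \<longleftrightarrow> a \<otimes>\<^bsub>G\<^esub> (g \<otimes>\<^bsub>G\<^esub> (b \<otimes>\<^bsub>G\<^esub> (h \<otimes>\<^bsub>G\<^esub> c))) \<in> A"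
    and dist: "(i, g) \<noteq> (j, h)" "(i, g) \<notin> set ys" "(j, h) \<notin> set ys"
    if gh: "g \<in> ?C" "h \<in> ?C" for g h
  proof -
    show d: "(i, g) \<noteq> (j, h)" "(i, g) \<notin> set ys" "(j, h) \<notin> set ys"
      using ij(2) iL by (force simp: L_def)+
    have "card (?S g h) = Suc (Suc n)" using d len by (simp add: distinct_card)
    moreover have "?S g h \<subseteq> ?I \<times> ?C" using gh Y iL by auto
    moreover have "inj_on fst (?S g h)"
      using Y(2) iL(1,2) ij(2) by (auto simp: inj_on_insert L_def)
    ultimately show "?S g h \<in> ?Y \<longleftrightarrow> a \<otimes>\<^bsub>G\<^esub> (g \<otimes>\<^bsub>G\<^esub> (b \<otimes>\<^bsub>G\<^esub> (h \<otimes>\<^bsub>G\<^esub> c))) \<in> A"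
      using Ycomplex_card_Suc[of "?S g h" "Suc n" G A] prod[OF gh] by simp
  qed
  have two: "v # w # ys \<in> osimp ?Y (Suc (Suc n)) \<longleftrightarrow>
      (\<exists>g\<in>?C. \<exists>h\<in>?C. a \<otimes>\<^bsub>G\<^esub> (g \<otimes>\<^bsub>G\<^esub> (b \<otimes>\<^bsub>G\<^esub> (h \<otimes>\<^bsub>G\<^esub> c))) \<in> A \<and>
        (v = (i, g) \<and> w = (j, h) \<or> w = (i, g) \<and> v = (j, h)))" (is "?l \<longleftrightarrow> ?r") for v w
  proof
    assume l: ?l
    then have d: "v \<noteq> w" "v \<notin> set ys" "w \<notin> set ys" and S: "insert v (insert w (set ys)) \<in> ?Y"
      by (auto simp: osimp_def)
    have "inj_on fst (insert v (insert w (set ys)))"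
      by (rule Ycomplex_inj_on[OF S])
    then have "fst v \<noteq> fst w" using d by (auto simp: inj_on_def)
    \<comment> \<open>Each new vertex alone extends \<open>ys\<close> inside the full skeleton, so
      \<open>one\<close> puts it on a free level. As v and w differ in level, they occupy i and j in
      one of the two orders.\<close>
    have "u # ys \<in> osimp ?Y (Suc n)" if "u = v \<or> u = w" for u
    proof -
      have "card (insert u (set ys)) \<le> Suc n" using len by (simp add: card_insert_if distinct_card)
      moreover have sub: "insert u (set ys) \<subseteq> insert v (insert w (set ys))" using that by auto
      moreover have "insert v (insert w (set ys)) \<subseteq> ?I \<times> ?C"
        using S by (simp add: Ycomplex_def)
      ultimately have "insert u (set ys) \<in> ?Y"
        using Ycomplex_card_le inj_on_subset[OF Ycomplex_inj_on[OF S] sub] subset_trans by metis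
      then show ?thesis using that d len by (auto simp: osimp_def)
    qed
    then have "v \<in> {i, j} \<times> ?C" "w \<in> {i, j} \<times> ?C"
      using one[of v] one[of w] by blast+
    then consider g h where "g \<in> ?C" "h \<in> ?C" "v = (i, g)" "w = (j, h)"
      | g h where "g \<in> ?C" "h \<in> ?C" "w = (i, g)" "v = (j, h)"
      using \<open>fst v \<noteq> fst w\<close> by auto
    then show ?r
    proof cases
      case 1
      then show ?thesis using mem[OF 1(1,2)] S by blast
    next
      case 2
      then show ?thesis using mem[OF 2(1,2)] S by (metis insert_commute)
    qed
  next
    assume ?r
    then obtain g h where gh: "g \<in> ?C" "h \<in> ?C"
      and A: "a \<otimes>\<^bsub>G\<^esub> (g \<otimes>\<^bsub>G\<^esub> (b \<otimes>\<^bsub>G\<^esub> (h \<otimes>\<^bsub>G\<^esub> c))) \<in> A"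
      and vw: "v = (i, g) \<and> w = (j, h) \<or> w = (i, g) \<and> v = (j, h)" by blast
    have "insert v (insert w (set ys)) = ?S g h" using vw by auto
    moreover have "?S g h \<in> ?Y" using mem[OF gh] A by simp
    ultimately show ?l using vw dist[OF gh] len by (auto simp: osimp_def)
  qed
  show thesis by (rule that[of i j a b c]) (use ij(2) abc one two in auto)
qed

text \<open>With x and y the values of \<phi> on the extensions to the two free levels, the first
  claim is \<open>join_pair_inequality\<close>; other vertices contribute 0 because a cochain
  vanishes off the ordered simplices. The second claim is the degree that multiplies the norm in
  \<open>oinner_up_laplacian\<close>.\<close>

lemma link_inequality:
  fixes G :: "('a, 'b) monoid_scheme" and n :: nat
  assumes "group G" and fin: "finite (carrier G)" and A: "A \<subseteq> carrier G"
    and \<phi>: "\<phi> \<in> cochains (Ycomplex G A (Suc n)) (Suc n)" and ys: "ys \<in> osimp (Ycomplex G A (Suc n)) n"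
  shows "(\<Sum>v\<in>\<Union>(Ycomplex G A (Suc n)). \<phi> (v # ys))\<^sup>2
      - (\<Sum>w\<in>\<Union>(Ycomplex G A (Suc n)). \<Sum>v\<in>\<Union>(Ycomplex G A (Suc n)).
          if v # w # ys \<in> osimp (Ycomplex G A (Suc n)) (Suc (Suc n)) then \<phi> (w # ys) * \<phi> (v # ys) else 0)
    \<ge> - nu G A * (\<Sum>v\<in>\<Union>(Ycomplex G A (Suc n)). (\<phi> (v # ys))\<^sup>2)"
    and "w # ys \<in> osimp (Ycomplex G A (Suc n)) (Suc n) \<Longrightarrow>
      card {v. v # w # ys \<in> osimp (Ycomplex G A (Suc n)) (Suc (Suc n))} = card A"
proof -
  let ?V = "\<Union>(Ycomplex G A (Suc n))" and ?C = "carrier G"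
  let ?P = "\<lambda>v w. v # w # ys \<in> osimp (Ycomplex G A (Suc n)) (Suc (Suc n))"
  interpret simplicial_complex "Ycomplex G A (Suc n)" by (rule Ycomplex_simplicial[OF fin])
  obtain i j a b c where ij: "i \<noteq> j" and abc: "a \<in> ?C" "b \<in> ?C" "c \<in> ?C"
    and one': "\<forall>v. v # ys \<in> osimp (Ycomplex G A (Suc n)) (Suc n) \<longleftrightarrow> v \<in> {i, j} \<times> ?C"
    and two': "\<forall>v w. ?P v w \<longleftrightarrow>
      (\<exists>g\<in>?C. \<exists>h\<in>?C. a \<otimes>\<^bsub>G\<^esub> (g \<otimes>\<^bsub>G\<^esub> (b \<otimes>\<^bsub>G\<^esub> (h \<otimes>\<^bsub>G\<^esub> c))) \<in> A \<and>
        (v = (i, g) \<and> w = (j, h) \<or> w = (i, g) \<and> v = (j, h)))"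
    using Ycomplex_link[OF assms(1) ys] .
  note one = one'[rule_format] and two = two'[rule_format]
  let ?Q = "\<lambda>g h. a \<otimes>\<^bsub>G\<^esub> (g \<otimes>\<^bsub>G\<^esub> (b \<otimes>\<^bsub>G\<^esub> (h \<otimes>\<^bsub>G\<^esub> c))) \<in> A"
  have P: "?P (i, g) (i, h) = False" "?P (j, g) (j, h) = False"
    "?P (i, g) (j, h) \<longleftrightarrow> g \<in> ?C \<and> h \<in> ?C \<and> ?Q g h"
    "?P (j, h) (i, g) \<longleftrightarrow> g \<in> ?C \<and> h \<in> ?C \<and> ?Q g h" for g h
    using ij by (auto simp: two)
  show "card {v. ?P v w} = card A" if O: "w # ys \<in> osimp (Ycomplex G A (Suc n)) (Suc n)"
  proof -
    consider g where "g \<in> ?C" "w = (i, g)" | h where "h \<in> ?C" "w = (j, h)"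
      using O one by auto
    then show ?thesis
    proof cases
      case 1
      have "{v. ?P v w} = Pair j ` {h \<in> ?C. ?Q g h}" using 1 ij by (auto simp: two)
      then show ?thesis
        using card_translate_right[OF assms(1) A abc 1(1)] by (simp add: card_image inj_on_def)
    next
      case 2
      have "{v. ?P v w} = Pair i ` {g \<in> ?C. ?Q g h}" using 2 ij by (auto simp: two)
      then show ?thesis
        using card_translate_left[OF assms(1) A abc 2(1)] by (simp add: card_image inj_on_def)
    qed
  qed
  have VC: "{i, j} \<times> ?C \<subseteq> ?V" using one osimp_Cons by blast
  have sumV: "(\<Sum>v\<in>?V. f v) = (\<Sum>g\<in>?C. f (i, g)) + (\<Sum>h\<in>?C. f (j, h))"
    if "\<And>v. v \<notin> {i, j} \<times> ?C \<Longrightarrow> f v = 0" for f :: "nat \<times> 'a \<Rightarrow> real"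
  proof -
    have "(\<Sum>v\<in>?V. f v) = (\<Sum>v\<in>{i, j} \<times> ?C. f v)"
      by (rule sum.mono_neutral_right[OF finite_vertices VC]) (use that in blast)
    also have "\<dots> = (\<Sum>l\<in>{i, j}. \<Sum>g\<in>?C. f (l, g))"
      by (simp add: sum.cartesian_product)
    finally show ?thesis using ij by simp
  qed
  have \<phi>0: "\<phi> (v # ys) = 0" if "v \<notin> {i, j} \<times> ?C" for v
    using that one cochains_eq_0[OF \<phi>] by blast
  define x y where "x g = \<phi> ((i, g) # ys)" and "y h = \<phi> ((j, h) # ys)" for g h
  let ?E = "{(g, h). g \<in> ?C \<and> h \<in> ?C \<and> ?Q g h}"
  define T where "T = (\<Sum>g\<in>?C. \<Sum>h\<in>?C. if ?Q g h then x g * y h else 0)"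
  have inner: "(\<Sum>v\<in>?V. if ?P v w then \<phi> (w # ys) * \<phi> (v # ys) else 0)
      = (\<Sum>g\<in>?C. if ?P (i, g) w then \<phi> (w # ys) * x g else 0)
        + (\<Sum>h\<in>?C. if ?P (j, h) w then \<phi> (w # ys) * y h else 0)" for w
    unfolding x_def y_def by (rule sumV) (auto simp: \<phi>0)
  \<comment> \<open>Every pair \<open>(g, h)\<close> is met twice, with w on level i and with w on
    level j. This is the 2 in \<open>join_pair_inequality\<close>.\<close>
  have "(\<Sum>w\<in>?V. \<Sum>v\<in>?V. if ?P v w then \<phi> (w # ys) * \<phi> (v # ys) else 0)
      = (\<Sum>g\<in>?C. \<Sum>v\<in>?V. if ?P v (i, g) then x g * \<phi> (v # ys) else 0)
        + (\<Sum>h\<in>?C. \<Sum>v\<in>?V. if ?P v (j, h) then y h * \<phi> (v # ys) else 0)"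
    unfolding x_def y_def by (rule sumV) (auto simp: \<phi>0 intro!: sum.neutral)
  also have "(\<Sum>g\<in>?C. \<Sum>v\<in>?V. if ?P v (i, g) then x g * \<phi> (v # ys) else 0) = T"
    unfolding T_def by (intro sum.cong refl) (simp add: inner[of "(i, _)", folded x_def] P cong: if_cong)
  also have "(\<Sum>h\<in>?C. \<Sum>v\<in>?V. if ?P v (j, h) then y h * \<phi> (v # ys) else 0)
      = (\<Sum>h\<in>?C. \<Sum>g\<in>?C. if ?Q g h then x g * y h else 0)"
    by (intro sum.cong refl) (simp add: inner[of "(j, _)", folded y_def] P mult.commute cong: if_cong)
  also have "\<dots> = T" unfolding T_def by (rule sum.swap)
  finally have double: "(\<Sum>w\<in>?V. \<Sum>v\<in>?V. if ?P v w then \<phi> (w # ys) * \<phi> (v # ys) else 0) = 2 * T"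
    by simp
  have "T = (\<Sum>(g, h)\<in>?C \<times> ?C. if ?Q g h then x g * y h else 0)"
    unfolding T_def by (rule sum.cartesian_product)
  also have "\<dots> = (\<Sum>(g, h)\<in>?E. x g * y h)"
    by (rule sum.mono_neutral_cong_right) (use fin in \<open>auto split: if_splits\<close>)
  finally have T: "T = (\<Sum>(g, h)\<in>?E. x g * y h)" .
  have s1: "(\<Sum>v\<in>?V. \<phi> (v # ys)) = (\<Sum>g\<in>?C. x g) + (\<Sum>h\<in>?C. y h)"
    unfolding x_def y_def by (rule sumV) (rule \<phi>0)
  have s2: "(\<Sum>v\<in>?V. (\<phi> (v # ys))\<^sup>2) = (\<Sum>g\<in>?C. (x g)\<^sup>2) + (\<Sum>h\<in>?C. (y h)\<^sup>2)"
    unfolding x_def y_def by (rule sumV) (simp add: \<phi>0)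
  show "(\<Sum>v\<in>?V. \<phi> (v # ys))\<^sup>2
      - (\<Sum>w\<in>?V. \<Sum>v\<in>?V. if ?P v w then \<phi> (w # ys) * \<phi> (v # ys) else 0)
    \<ge> - nu G A * (\<Sum>v\<in>?V. (\<phi> (v # ys))\<^sup>2)"
    unfolding s1 s2 double T by (rule join_pair_inequality[OF assms(1) fin A abc])
qed

section \<open>Estimate of an arbitrary eigenvalue\<close>

theorem theorem1p3:
  fixes G :: "('a, 'b) monoid_scheme" and A :: "'a set" and k :: nat
  assumes "group G" and "finite (carrier G)" and "k \<ge> 1"
    and "A \<subseteq> carrier G" and "A \<noteq> {}"
  shows "spectral_gap (Ycomplex G A k) k \<ge> real (card A) - real k * nu G A"
proof -
  interpret group G by fact
  obtain n where k: "k = Suc n" using assms(3) by (cases k) auto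
  let ?Y = "Ycomplex G A (Suc n)"
  interpret simplicial_complex ?Y by (rule Ycomplex_simplicial[OF assms(2)])
  let ?V = "\<Union>?Y"
  \<comment> \<open>A simplex on the first k levels with all labels the unit lies in the full
    skeleton; it makes the space of cochains nonzero, so an eigenvalue exists.\<close>
  have "(\<lambda>i. (i, \<one>\<^bsub>G\<^esub>)) ` {1..Suc n} \<in> faces (Suc n)"
  proof -
    have c: "card ((\<lambda>i. (i, \<one>\<^bsub>G\<^esub>)) ` {1..Suc n}) = Suc n" by (simp add: card_image inj_on_def)
    then show ?thesis
      unfolding faces_def using Ycomplex_card_le[of "(\<lambda>i. (i, \<one>\<^bsub>G\<^esub>)) ` {1..Suc n}" "Suc n" G A]
      by (auto simp: inj_on_def)
  qed
  then have ne: "faces (Suc n) \<noteq> {}" by blast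
  have bound: "real (card A) - real (Suc n) * nu G A \<le> e" if e: "e \<in> lap_eigenvalues ?Y (Suc n)" for e
  proof -
    obtain \<phi> where \<phi>: "\<phi> \<in> cochains ?Y (Suc n)" "\<phi> \<noteq> (\<lambda>_. 0)"
      "laplacian ?Y (Suc n) \<phi> = (\<lambda>xs. e * \<phi> xs)"
      using e by (auto simp: lap_eigenvalues_def)
    let ?N = "oinner ?Y (Suc n) \<phi> \<phi>"
    obtain zs where zs: "\<phi> zs \<noteq> 0" using \<phi>(2) by auto
    then have "zs \<in> osimp ?Y (Suc n)" using cochains_eq_0[OF \<phi>(1)] by blast
    then have Npos: "?N > 0"
      unfolding oinner_def using zs
      by (intro sum_pos2[OF finite_osimp, of zs]) (auto simp: zero_less_mult_iff not_less)
    define S where "S ys = (\<Sum>v\<in>?V. \<phi> (v # ys))" for ys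
    define D where "D ys = (\<Sum>w\<in>?V. \<Sum>v\<in>?V.
        if v # w # ys \<in> osimp ?Y (Suc (Suc n)) then \<phi> (w # ys) * \<phi> (v # ys) else 0)" for ys
    have link: "- nu G A * (\<Sum>v\<in>?V. (\<phi> (v # ys))\<^sup>2) \<le> (S ys)\<^sup>2 - D ys" if "ys \<in> osimp ?Y n" for ys
      unfolding S_def D_def by (rule link_inequality(1)[OF assms(1,2,4) \<phi>(1) that])
    have card: "card {v. v # zs \<in> osimp ?Y (Suc (Suc n))} = card A" if O: "zs \<in> osimp ?Y (Suc n)" for zs
    proof -
      obtain w ys where zs: "zs = w # ys" using O by (cases zs) (auto simp: osimp_def)
      then have "ys \<in> osimp ?Y n" using O osimp_Cons by blast
      then show ?thesis
        using link_inequality(2)[OF assms(1,2,4) \<phi>(1), of ys w] O zs by simp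
    qed
    have N: "?N = (\<Sum>ys\<in>osimp ?Y n. \<Sum>v\<in>?V. (\<phi> (v # ys))\<^sup>2)"
      unfolding oinner_def power2_eq_square
      by (rule sum_osimp_Suc) (simp add: cochains_eq_0[OF \<phi>(1)])
    \<comment> \<open>The Rayleigh quotient in the ordered normalisation, which differs from
      \<open>cinner\<close> by k! in numerator and denominator alike.\<close>
    have "e * ?N = oinner ?Y (Suc n) \<phi> (laplacian ?Y (Suc n) \<phi>)"
      unfolding \<phi>(3) by (simp add: oinner_def sum_distrib_left mult_ac)
    also have "\<dots> = real (Suc n) * (\<Sum>ys\<in>osimp ?Y n. (S ys)\<^sup>2)
        + (real (card A) * ?N - real (Suc n) * (\<Sum>ys\<in>osimp ?Y n. D ys))"
    proof -
      have "oinner ?Y n (cadj ?Y \<phi>) (cadj ?Y \<phi>) = (\<Sum>ys\<in>osimp ?Y n. (S ys)\<^sup>2)"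
        by (simp add: oinner_def cadj_def S_def power2_eq_square)
      moreover have "(\<Sum>zs\<in>osimp ?Y (Suc n).
          real (card {v. v # zs \<in> osimp ?Y (Suc (Suc n))}) * (\<phi> zs)\<^sup>2) = real (card A) * ?N"
        by (simp add: oinner_def sum_distrib_left card power2_eq_square)
      ultimately show ?thesis
        unfolding oinner_laplacian[OF \<phi>(1) \<phi>(1)] oinner_up_laplacian[OF \<phi>(1)] D_def by simp
    qed
    also have "\<dots> = real (card A) * ?N + real (Suc n) * (\<Sum>ys\<in>osimp ?Y n. (S ys)\<^sup>2 - D ys)"
      by (simp add: sum_subtractf right_diff_distrib)
    \<comment> \<open>By \<open>N\<close> each ordered simplex occurs once, split into first vertex
      and rest, so the link estimates sum to one multiple of \<open>?N\<close>. The factor k is the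
      number of positions and is already in front of the sum.\<close>
    also have "\<dots> \<ge> real (card A) * ?N + real (Suc n) * (- nu G A * ?N)"
    proof (intro add_left_mono mult_left_mono)
      show "- nu G A * ?N \<le> (\<Sum>ys\<in>osimp ?Y n. (S ys)\<^sup>2 - D ys)"
        unfolding N by (subst sum_distrib_left) (intro sum_mono link)
    qed simp
    finally have "(real (card A) - real (Suc n) * nu G A) * ?N \<le> e * ?N"
      by (simp add: algebra_simps)
    then show ?thesis using Npos by simp
  qed
  show ?thesis
    unfolding k spectral_gap_def
    using lap_eigenvalues_finite_nonempty[OF ne] bound by simp
qed

end
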